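(* For each $n\in\mathbb{N}$, $\mathsf{styl}_n$ generates the variety $\boldsymbol{\mathcal{V}}(J_n)$ and the pseudovariety $\boldsymbol{\mathcal{J}}_n$. Furthermore, $\boldsymbol{\mathcal{V}}(\mathsf{styl}_n)\subsetneq\boldsymbol{\mathcal{V}}(\mathsf{styl}_{n+1})$, and $\mathsf{styl}_n$ is finitely based if and only if $n\le 3$: (1) $\mathsf{styl}_1$ admits the basis $x^2\approx x$, $xy\approx yx$; (2) $\mathsf{styl}_2$ admits the basis $xyxzx\approx xyzx$, $(xy)^2\approx(yx)^2$; (3) $\mathsf{styl}_3$ admits the basis $xyx^2zx\approx xyxzx$, $xyzx^2tz\approx xyxzx^2tz$, $zyx^2ztx\approx zyx^2zxtx$, $(xy)^3\approx(yx)^3$.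
   Context: $\mathbb{N}=\{1,2,3,\dots\}$ and $\mathcal{A}_n=\{1<2<\cdots<n\}$. The stylic monoid of rank $n$, $\mathsf{styl}_n$, is the monoid presented by generators $\mathcal{A}_n$ and relations $acb=cab$ (for $a\le b<c$), $bac=bca$ (for $a<b\le c$), and $a^2=a$ (for $a\in\mathcal{A}_n$); it is finite. A monoid identity over an alphabet of variables is a formal equality $u\approx v$ of words; a monoid $M$ satisfies it if $\psi(u)=\psi(v)$ for every monoid morphism $\psi$ from the free monoid on the variables to $M$. A variety is a class of monoids closed under homomorphic images, submonoids and direct products (equivalently, the class of all monoids satisfying some set of identities); a pseudovariety is a class of finite monoids closed under homomorphic images, submonoids and finitary direct products. $\boldsymbol{\mathcal{V}}(M)$ is the variety generated by the monoid $M$. $J_n$ is the set of all identities $u\approx v$ such that $u$ and $v$ have the same (scattered) subsequences of length $\le n$; $\boldsymbol{\mathcal{V}}(J_n)$ is the variety of all monoids satisfying every identity in $J_n$; $\boldsymbol{\mathcal{J}}_n$ is the pseudovariety corresponding, under Eilenberg's correspondence, to the class of piecewise testable languages of height $n$, and it consists of all finite monoids satisfying every identity in $J_n$. A basis of a monoid (or of its variety) is a set of identities satisfied by it of which every identity it satisfies is a consequence (i.e. holds in every monoid satisfying the basis); a monoid is finitely based if it admits a finite basis. *)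

theory Defs
  imports
    "HOL-Algebra.Product_Groups"
    "HOL-Library.Sublist"
    "HOL-Library.Infinite_Typeclass"
begin

section \<open>Words, congruences and monoid presentations\<close>

definition free_monoid :: "'a set \<Rightarrow> 'a list monoid" where
  "free_monoid A = \<lparr>carrier = lists A, monoid.mult = (@), one = []\<rparr>"

text \<open>The quotient of the free monoid on \<open>A\<close> by \<open>R\<close>, where \<open>R\<close> is meant to be a
  congruence on \<open>lists A\<close>; then the product of the classes of \<open>u\<close> and \<open>v\<close> is the
  class of \<open>u @ v\<close>.\<close>

definition quotient_monoid :: "'a set \<Rightarrow> ('a list \<times> 'a list) set \<Rightarrow> 'a list set monoid" where
  "quotient_monoid A R =
     \<lparr>carrier = lists A // R,
      monoid.mult = (\<lambda>C D. R `` {u @ v | u v. u \<in> C \<and> v \<in> D}),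
      one = R `` {[]}\<rparr>"

inductive_set generated_congruence :: "'a set \<Rightarrow> ('a list \<times> 'a list) set \<Rightarrow> ('a list \<times> 'a list) set"
  for A :: "'a set" and R :: "('a list \<times> 'a list) set" where
  base: "(u, v) \<in> R \<Longrightarrow> u \<in> lists A \<Longrightarrow> v \<in> lists A \<Longrightarrow> (u, v) \<in> generated_congruence A R"
| refl: "u \<in> lists A \<Longrightarrow> (u, u) \<in> generated_congruence A R"
| sym: "(u, v) \<in> generated_congruence A R \<Longrightarrow> (v, u) \<in> generated_congruence A R"
| trans: "(u, v) \<in> generated_congruence A R \<Longrightarrow> (v, w) \<in> generated_congruence A R \<Longrightarrow>
          (u, w) \<in> generated_congruence A R"
| mult: "(u, v) \<in> generated_congruence A R \<Longrightarrow> (u', v') \<in> generated_congruence A R \<Longrightarrow>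
          (u @ u', v @ v') \<in> generated_congruence A R"

definition presented_monoid :: "'a set \<Rightarrow> ('a list \<times> 'a list) set \<Rightarrow> 'a list set monoid" where
  "presented_monoid A R = quotient_monoid A (generated_congruence A R)"

definition stylic_relations :: "nat \<Rightarrow> (nat list \<times> nat list) set" where
  "stylic_relations n =
     {([a, c, b], [c, a, b]) | a b c. {a, b, c} \<subseteq> {1..n} \<and> a \<le> b \<and> b < c} \<union>
     {([b, a, c], [b, c, a]) | a b c. {a, b, c} \<subseteq> {1..n} \<and> a < b \<and> b \<le> c} \<union>
     {([a, a], [a]) | a. a \<in> {1..n}}"

definition styl :: "nat \<Rightarrow> nat list set monoid" where
  "styl n = presented_monoid {1..n} (stylic_relations n)"


section \<open>Identities\<close>

text \<open>Variables are natural numbers; the identity \<open>u \<approx> v\<close> is the pair \<open>(u, v)\<close>.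
  Membership in \<^const>\<open>hom\<close> does not ask for preservation of the unit.\<close>

type_synonym identity = "nat list \<times> nat list"

definition satisfies :: "('a, 'c) monoid_scheme \<Rightarrow> identity \<Rightarrow> bool" where
  "satisfies M e \<longleftrightarrow>
     (\<forall>\<psi> \<in> hom (free_monoid UNIV) M. \<psi> [] = \<one>\<^bsub>M\<^esub> \<longrightarrow> \<psi> (fst e) = \<psi> (snd e))"

definition models :: "identity set \<Rightarrow> 'u monoid set" where
  "models E = {N. monoid N \<and> (\<forall>e\<in>E. satisfies N e)}"

definition J_identities :: "nat \<Rightarrow> identity set" where
  "J_identities n = {(u, v). \<forall>w. length w \<le> n \<longrightarrow> (subseq w u \<longleftrightarrow> subseq w v)}"

text \<open>The type \<open>'u\<close> is the universe of the monoids over which consequence is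
  tested. An identity has countably many letters, so if it fails in some monoid satisfying \<open>B\<close>
  then it fails in a countable one, and every infinite \<open>'u\<close> gives the same notion.\<close>

definition is_basis :: "'u itself \<Rightarrow> identity set \<Rightarrow> ('a, 'c) monoid_scheme \<Rightarrow> bool" where
  "is_basis _ B M \<longleftrightarrow>
     (\<forall>e\<in>B. satisfies M e) \<and>
     (\<forall>e. satisfies M e \<longrightarrow> (\<forall>N \<in> (models B :: 'u monoid set). satisfies N e))"

definition finitely_based :: "'u itself \<Rightarrow> ('a, 'c) monoid_scheme \<Rightarrow> bool" where
  "finitely_based U M \<longleftrightarrow> (\<exists>B. finite B \<and> is_basis U B M)"


section \<open>Varieties and pseudovarieties\<close>

text \<open>A class of monoids is represented by its members with carrier in a universe type
  \<open>'u\<close>, taken to be infinite. An infinite product of such monoids need not fit into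
  \<open>'u\<close> although some homomorphic images of its submonoids do. Therefore closure
  under homomorphic images, submonoids and products is required in a single step,
  the intermediate product living in a function type. For infinite \<open>'u\<close>, products over
  index sets of cardinality at most that of \<open>'u\<close> already reach every monoid on
  \<open>'u\<close> in the generated variety, so the index type \<open>'u \<Rightarrow> 'u\<close> is large enough.\<close>

definition variety :: "'u monoid set \<Rightarrow> bool" where
  "variety K \<longleftrightarrow>
     (\<forall>N\<in>K. monoid N) \<and>
     (\<forall>(I :: ('u \<Rightarrow> 'u) set) M S N f.
        (\<forall>i\<in>I. M i \<in> K) \<and> submonoid S (product_group I M) \<and> monoid N \<and>
        f \<in> epi ((product_group I M)\<lparr>carrier := S\<rparr>) N \<longrightarrow> N \<in> K)"

text \<open>Finite products of finite monoids do fit into an infinite \<open>'u\<close> up to isomorphism,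
  so here the three closure conditions can be stated separately. The empty index set yields
  the trivial monoid.\<close>

definition pseudovariety :: "'u monoid set \<Rightarrow> bool" where
  "pseudovariety K \<longleftrightarrow>
     (\<forall>N\<in>K. monoid N \<and> finite (carrier N)) \<and>
     (\<forall>M\<in>K. \<forall>N f. monoid N \<and> f \<in> epi M N \<longrightarrow> N \<in> K) \<and>
     (\<forall>M\<in>K. \<forall>S. submonoid S M \<longrightarrow> M\<lparr>carrier := S\<rparr> \<in> K) \<and>
     (\<forall>(I :: nat set) M N.
        finite I \<and> (\<forall>i\<in>I. M i \<in> K) \<and> monoid N \<and> N \<cong> product_group I M \<longrightarrow> N \<in> K)"

definition copies :: "('a, 'c) monoid_scheme \<Rightarrow> 'u monoid set" where
  "copies M = {N. monoid N \<and> N \<cong> M}"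

definition generated_variety :: "('a, 'c) monoid_scheme \<Rightarrow> 'u monoid set" where
  "generated_variety M = \<Inter>{K. variety K \<and> copies M \<subseteq> K}"

definition generated_pseudovariety :: "'u monoid set \<Rightarrow> 'u monoid set" where
  "generated_pseudovariety X = \<Inter>{K. pseudovariety K \<and> X \<subseteq> K}"


section \<open>Piecewise testable languages and Eilenberg's correspondence\<close>

definition syntactic_congruence :: "'a set \<Rightarrow> 'a list set \<Rightarrow> ('a list \<times> 'a list) set" where
  "syntactic_congruence A L =
     {(u, v). u \<in> lists A \<and> v \<in> lists A \<and>
        (\<forall>p \<in> lists A. \<forall>q \<in> lists A. p @ u @ q \<in> L \<longleftrightarrow> p @ v @ q \<in> L)}"

definition syntactic_monoid :: "'a set \<Rightarrow> 'a list set \<Rightarrow> 'a list set monoid" where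
  "syntactic_monoid A L = quotient_monoid A (syntactic_congruence A L)"

text \<open>Boolean combinations of languages \<open>A\<^sup>* a\<^sub>1 A\<^sup>* \<dots> a\<^sub>k A\<^sup>*\<close> with \<open>k \<le> n\<close>; such a
  language consists of the words over \<open>A\<close> having \<open>a\<^sub>1 \<dots> a\<^sub>k\<close> as a subsequence.\<close>

inductive_set piecewise_testable :: "nat \<Rightarrow> 'a set \<Rightarrow> 'a list set set"
  for n :: nat and A :: "'a set" where
  basic: "w \<in> lists A \<Longrightarrow> length w \<le> n \<Longrightarrow> {u \<in> lists A. subseq w u} \<in> piecewise_testable n A"
| compl: "L \<in> piecewise_testable n A \<Longrightarrow> lists A - L \<in> piecewise_testable n A"
| union: "L \<in> piecewise_testable n A \<Longrightarrow> L' \<in> piecewise_testable n A \<Longrightarrow>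
          L \<union> L' \<in> piecewise_testable n A"

text \<open>A class of languages assigns a set of languages to each finite alphabet. Eilenberg's
  correspondence sends it to the pseudovariety generated by the syntactic monoids of its members.\<close>

definition eilenberg_pseudovariety :: "(nat set \<Rightarrow> nat list set set) \<Rightarrow> 'u monoid set" where
  "eilenberg_pseudovariety V =
     generated_pseudovariety (\<Union>A \<in> {A. finite A}. \<Union>L \<in> V A. copies (syntactic_monoid A L))"

definition J_pseudovariety :: "nat \<Rightarrow> 'u monoid set" where
  "J_pseudovariety n = eilenberg_pseudovariety (piecewise_testable n)"

end

theory Submission
  imports Defs
begin

text \<open>Write \<open>u \<sim>\<^sub>n v\<close> if \<open>u\<close> and \<open>v\<close> have the same subsequences of length at most \<open>n\<close>. Any two
  \<open>\<sim>\<^sub>n\<close>-equivalent words have a common superword in their class, so \<open>\<sim>\<^sub>n\<close> is generated by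
  insertions \<open>pq \<sim>\<^sub>n paq\<close> of single letters, and these are exactly the ones for which
  \<open>p \<sim>\<^sub>k pa\<close> and \<open>q \<sim>\<^sub>l aq\<close> for some \<open>k + l = n\<close>.

  In the stylic monoid a letter \<open>a\<close> absorbs its recurrences across smaller letters on its right and
  across larger letters on its left. As \<open>k + l = n\<close> forces \<open>k \<ge> n + 1 - a\<close> or \<open>l \<ge> a\<close>, one of \<open>pa = p\<close>
  and \<open>aq = q\<close> holds in it. Conversely, the subsequences \<open>j, j - 1, \<dots>, i\<close> of a word are invariants
  of its class, so its identities are exactly those of \<open>J\<^sub>n\<close>. The (pseudo)variety statements follow
  from Birkhoff's construction.

  For \<open>n \<le> 3\<close> the bases derive every single-letter insertion. For \<open>n \<ge> 4\<close> there is, for each \<open>r\<close>, a word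
  that no identity of \<open>J\<^sub>n\<close> in fewer than \<open>r\<close> variables changes although it is \<open>\<sim>\<^sub>n\<close>-equivalent to
  another word; the monoid of its factors with a zero separates the two.\<close>

section \<open>Simon's congruence\<close>

text \<open>Say that \<open>p\<close> absorbs \<open>a\<close> at depth \<open>k\<close> if
  \<open>simon k p (p @ [a])\<close>, and dually on the right. The derivations are stated for a map
  \<open>\<psi>\<close> on words, which is the class map of the stylic congruence in one place and
  the evaluation of words in a model in another; \<open>\<psi> \<circ> rev\<close> yields the mirror
  image of each argument. The split \<open>k + l = n\<close> decides where finite bases stop. With
  \<open>l = 0\<close>, letters absorbed at depth \<open>n - 1\<close> can be exchanged by means of
  \<open>(xy)^n \<approx> (yx)^n\<close>. With \<open>k = 2\<close> and \<open>l = 1\<close>, the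
  inserted letter may stop anywhere in the block that separates it from its previous occurrence, so
  it crosses that block one letter at a time. With \<open>l \<ge> 2\<close> such a stop can create a
  new subsequence of length two on the right; the block must then be crossed at once, however many
  variables it needs. The word used for \<open>n \<ge> 4\<close> realizes this with the split
  \<open>2 + (n - 2)\<close>.\<close>

definition simon :: "nat \<Rightarrow> 'a list \<Rightarrow> 'a list \<Rightarrow> bool" where
  "simon n u v \<longleftrightarrow> (\<forall>w. length w \<le> n \<longrightarrow> (subseq w u \<longleftrightarrow> subseq w v))"

lemma J_identities_iff: "e \<in> J_identities n \<longleftrightarrow> simon n (fst e) (snd e)"
  by (cases e) (auto simp: J_identities_def simon_def)

lemma simonD: "simon n u v \<Longrightarrow> length w \<le> n \<Longrightarrow> subseq w u \<longleftrightarrow> subseq w v"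
  by (auto simp: simon_def)

lemma simon_refl [simp]: "simon n u u"
  by (simp add: simon_def)

lemma simon_sym: "simon n u v \<Longrightarrow> simon n v u"
  by (simp add: simon_def)

lemma simon_trans: "simon n u v \<Longrightarrow> simon n v w \<Longrightarrow> simon n u w"
  by (simp add: simon_def)

lemma simon_mono: "simon n u v \<Longrightarrow> m \<le> n \<Longrightarrow> simon m u v"
  by (simp add: simon_def)

lemma simon_0 [simp]: "simon 0 u v"
  by (simp add: simon_def)

lemma simon_set:
  assumes "simon n u v" "n \<ge> 1"
  shows "set u = set v"
proof -
  have "x \<in> set u \<longleftrightarrow> x \<in> set v" for x
    using simonD[OF assms(1), of "[x]"] assms(2) by (simp add: subseq_singleton_left)
  then show ?thesis by blast
qed

text \<open>The marked letter \<open>a\<close> is matched on one side of the cut and takes along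
  everything before it or everything after it.\<close>

lemma subseq_split_Cons:
  assumes "subseq (x @ a # y) (p @ q)"
  shows "subseq (x @ [a]) p \<or> subseq (a # y) q"
proof -
  obtain s t where st: "x @ a # y = s @ t" "subseq s p" "subseq t q"
    using assms by (auto simp: subseq_append_iff)
  show ?thesis
  proof (cases "length s \<le> length x")
    case True
    then have "suffix (a # y) t"
      using st(1) by (metis suffixI append_eq_append_conv_if)
    then show ?thesis
      using st(3) subseq_order.order_trans by blast
  next
    case False
    have "prefix (x @ [a]) (s @ t)"
      unfolding st(1)[symmetric] by simp
    then have "prefix (x @ [a]) s"
      by (rule prefix_length_prefix) (use False in auto)
    then show ?thesis
      using st(2) subseq_order.order_trans by blast
  qed
qed

lemma simon_append:
  assumes "simon n u v" "simon n u' v'"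
  shows "simon n (u @ u') (v @ v')"
proof -
  have "subseq w (v @ v')"
    if "length w \<le> n" "subseq w (u @ u')" "simon n u v" "simon n u' v'" for w u u' v v' :: "'a list"
  proof -
    obtain x y where "w = x @ y" "subseq x u" "subseq y u'"
      using \<open>subseq w (u @ u')\<close> by (auto simp: subseq_append_iff)
    then show ?thesis
      using that by (intro list_emb_append_mono[of "(=)" x v y v', folded \<open>w = x @ y\<close>])
        (auto simp: simon_def)
  qed
  then show ?thesis
    using assms simon_sym unfolding simon_def[of n "u @ u'"] by metis
qed

lemma simon_context: "simon n u v \<Longrightarrow> simon n (p @ u @ q) (p @ v @ q)"
  by (intro simon_append) auto

lemma subseq_insert: "subseq (p @ q) (p @ r @ q)"
  by (simp add: subseq_append' list_emb_append2)

lemma simon_between: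
  assumes "simon n u w" "subseq u v" "subseq v w"
  shows "simon n u v"
  using assms subseq_order.order_trans unfolding simon_def by blast

lemma not_simon_insert:
  assumes "\<not> simon n (p @ q) (p @ r @ q)"
  obtains w where "length w \<le> n" "subseq w (p @ r @ q)" "\<not> subseq w (p @ q)"
  using assms subseq_insert subseq_order.order_trans unfolding simon_def by blast

text \<open>A subsequence created by inserting \<open>b\<close> has to use that \<open>b\<close>. If
  \<open>x @ [b]\<close> embedded in \<open>p\<close>, or \<open>b # y\<close> in \<open>q\<close>,
  another \<open>b\<close> could have been used instead.\<close>

lemma subseq_insert_letterE:
  assumes "subseq w (p @ b # q)" "\<not> subseq w (p @ q)"
  obtains x y where "w = x @ b # y" "subseq x p" "subseq y q"
    "\<not> subseq (x @ [b]) p" "\<not> subseq (b # y) q"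
proof -
  obtain x y' where xy: "w = x @ y'" "subseq x p" "subseq y' (b # q)"
    using assms(1) by (auto simp: subseq_append_iff)
  have "\<not> subseq y' q"
    using xy assms(2) by (auto simp: subseq_append_iff)
  then obtain y where y: "y' = b # y" "subseq y q"
    using xy(3) by (cases y') (auto split: if_splits)
  moreover have "\<not> subseq (x @ [b]) p"
    using y assms(2) xy(1) list_emb_append_mono[of "(=)" "x @ [b]" p y q] by auto
  ultimately show thesis
    using that xy \<open>\<not> subseq y' q\<close> by blast
qed

text \<open>At the first letters \<open>a\<close> and \<open>b\<close> where two equivalent words
  differ, one of them can be put in front of the other. If both insertions failed, each would create
  a subsequence of length at most \<open>n\<close>, and these two cannot coexist.\<close>

lemma divergent_letters:
  assumes sim: "simon n (p @ a # s) (p @ b # t)" and "a \<noteq> b"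
  shows "simon n (p @ a # s) (p @ b # a # s) \<or> simon n (p @ b # t) (p @ a # b # t)"
proof (rule ccontr)
  assume neg: "\<not> ?thesis"
  obtain r where r: "length r \<le> n" "subseq r (p @ b # a # s)" "\<not> subseq r (p @ a # s)"
    using neg not_simon_insert[of n p "a # s" "[b]"] by auto
  obtain r1 r2 where r12: "r = r1 @ b # r2" "subseq r1 p" "subseq r2 (a # s)"
    "\<not> subseq (r1 @ [b]) p" "\<not> subseq (b # r2) (a # s)"
    using subseq_insert_letterE[OF r(2,3)] by metis
  obtain q where q: "length q \<le> n" "subseq q (p @ a # b # t)" "\<not> subseq q (p @ b # t)"
    using neg not_simon_insert[of n p "b # t" "[a]"] by auto
  obtain q1 q2 where q12: "q = q1 @ a # q2" "subseq q1 p" "subseq q2 (b # t)"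
    "\<not> subseq (q1 @ [a]) p" "\<not> subseq (a # q2) (b # t)"
    using subseq_insert_letterE[OF q(2,3)] by metis
  have "\<not> subseq r (p @ b # t)"
    using r(1,3) sim by (simp add: simon_def)
  then have r2t: "\<not> subseq r2 t"
    using r12(1,2) by (auto simp: subseq_append_iff)
  have "\<not> subseq q (p @ a # s)"
    using q(1,3) sim by (simp add: simon_def)
  then have q2s: "\<not> subseq q2 s"
    using q12(1,2) by (auto simp: subseq_append_iff)
  \<comment> \<open>Exchanging the tails of \<open>r\<close> and \<open>q\<close> gives two words longer than \<open>n\<close> but of the same
    total length, which is at most \<open>2n\<close>.\<close>
  have mixed: "n < length x1 + 1 + length y2"
    if mix: "simon n (p @ a # s) (p @ b # t)" "a \<noteq> b" "subseq x1 p" "subseq y2 (a # s)"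
      "\<not> subseq (x1 @ [a]) p" "\<not> subseq y2 t" for a b s t x1 y2
  proof (rule ccontr)
    assume short: "\<not> n < length x1 + 1 + length y2"
    \<comment> \<open>A leading \<open>a\<close> of \<open>y2\<close> is split off here and restored
      in \<open>x1 @ a # y\<close>, so that this word is no longer than \<open>n\<close> in either
      case.\<close>
    obtain y where y: "subseq y s" "y2 = a # y \<or> y2 = y"
      using mix(4) by (cases y2) (auto split: if_splits)
    have "subseq (x1 @ a # y) (p @ a # s)"
      using mix(3) y(1) by (intro list_emb_append_mono) auto
    then have "subseq (x1 @ a # y) (p @ b # t)"
      using mix(1) short y(2) by (auto simp: simon_def)
    then have "subseq (a # y) (b # t)"
      using subseq_split_Cons mix(5) by metis
    then have "subseq (a # y) t"
      using mix(2) by simp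
    then show False
      using mix(6) y(2) subseq_Cons' by metis
  qed
  have "n < length q1 + 1 + length r2"
    using mixed[OF sim] assms(2) q12 r12 r2t by blast
  moreover have "n < length r1 + 1 + length q2"
    using mixed[OF simon_sym[OF sim]] assms(2) q12 r12 q2s by blast
  ultimately show False
    using r(1) q(1) r12(1) q12(1) by simp
qed

text \<open>Both words are read from the left, with \<open>p\<close> as the part already made
  common. After an insertion from \<open>divergent_letters\<close>, the word that receives the
  letter keeps its tail and the other one loses the head of its tail, so the total length of the
  tails decreases.\<close>

lemma simon_common_superword:
  assumes "simon n u v"
  obtains w where "subseq u w" "subseq v w" "simon n u w"
proof -
  define P where "P u v \<longleftrightarrow> (\<exists>w. subseq u w \<and> subseq v w \<and> simon n u w)" for u v :: "'a list"
  have "simon n (p @ s) (p @ t) \<Longrightarrow> P (p @ s) (p @ t)" for p s t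
  proof (induction "length s + length t" arbitrary: p s t rule: less_induct)
    case less
    show ?case
    proof (cases s)
      case Nil
      then show ?thesis
        using less.prems unfolding P_def by (metis append_Nil2 prefixI prefix_imp_subseq subseq_order.order_refl)
    next
      case s: (Cons a s')
      show ?thesis
      proof (cases t)
        case Nil
        then show ?thesis
          unfolding P_def by (metis append_Nil2 prefixI prefix_imp_subseq subseq_order.order_refl simon_refl)
      next
        case t: (Cons b t')
        show ?thesis
        proof (cases "a = b")
          case True
          then show ?thesis
            using less.hyps[of s' t' "p @ [a]"] less.prems s t by auto
        next
          case False
          have sim: "simon n (p @ a # s') (p @ b # t')"
            using less.prems s t by simp
          from divergent_letters[OF this False] show ?thesis
          proof
            assume 1: "simon n (p @ a # s') (p @ b # a # s')"
            have "simon n ((p @ [b]) @ a # s') ((p @ [b]) @ t')"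
              using simon_trans[OF simon_sym[OF 1] sim] by simp
            then have "P ((p @ [b]) @ a # s') ((p @ [b]) @ t')"
              by (rule less.hyps[rotated]) (simp add: s t)
            then obtain w where w: "subseq (p @ b # a # s') w" "subseq (p @ b # t') w"
              "simon n (p @ b # a # s') w"
              by (auto simp: P_def)
            have "subseq (p @ a # s') w"
              using subseq_insert[of p "a # s'" "[b]"] w(1) subseq_order.order_trans by fastforce
            then show ?thesis
              using simon_trans[OF 1 w(3)] w(2) unfolding P_def s t by blast
          next
            assume 1: "simon n (p @ b # t') (p @ a # b # t')"
            have "simon n ((p @ [a]) @ s') ((p @ [a]) @ b # t')"
              using simon_trans[OF sim 1] by simp
            then have "P ((p @ [a]) @ s') ((p @ [a]) @ b # t')"
              by (rule less.hyps[rotated]) (simp add: s t)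
            then obtain w where w: "subseq (p @ a # s') w" "subseq (p @ a # b # t') w"
              "simon n (p @ a # s') w"
              by (auto simp: P_def)
            have "subseq (p @ b # t') w"
              using subseq_insert[of p "b # t'" "[a]"] w(2) subseq_order.order_trans by fastforce
            then show ?thesis
              using w(1,3) unfolding P_def s t by blast
          qed
        qed
      qed
    qed
  qed
  from this[of "[]" u v] show thesis
    using assms that by (auto simp: P_def)
qed

text \<open>Both words climb to a common superword one letter at a time, and by
  \<open>simon_between\<close> no intermediate word leaves the class. The premise
  \<open>n \<ge> 1\<close> keeps the letters of the superword in \<open>A\<close>.\<close>

lemma simon_imp_eq:
  fixes \<psi> :: "'a list \<Rightarrow> 'b"
  assumes insert: "\<And>p q a. simon n (p @ q) (p @ a # q) \<Longrightarrow> set (p @ q) \<subseteq> A \<Longrightarrow> \<psi> (p @ a # q) = \<psi> (p @ q)"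
    and sim: "simon n u v" and "n \<ge> 1" "set u \<subseteq> A"
  shows "\<psi> u = \<psi> v"
proof -
  have chain: "\<psi> (p @ w) = \<psi> (p @ u)"
    if "subseq u w" "simon n (p @ u) (p @ w)" "set (p @ w) \<subseteq> A" for p u w
    using that
  proof (induction arbitrary: p)
    case (list_emb_Nil w)
    then show ?case
    proof (induction w arbitrary: p rule: rev_induct)
      case (snoc a w)
      have 1: "simon n (p @ []) (p @ w)"
        by (rule simon_between[OF snoc.prems(1)]) (auto simp: subseq_append')
      then have "simon n ((p @ w) @ []) ((p @ w) @ [a])"
        using simon_trans[OF simon_sym[OF 1] snoc.prems(1)] by simp
      then show ?case
        using snoc.IH[of p] 1 insert[of "p @ w" "[]" a] snoc.prems by auto
    qed simp
  next
    case (list_emb_Cons u w a)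
    have 1: "simon n (p @ u) (p @ w)"
      by (rule simon_between[OF list_emb_Cons.prems(1)]) (auto simp: subseq_append' list_emb_Cons.hyps)
    then have "simon n (p @ w) (p @ a # w)"
      using list_emb_Cons.prems(1) simon_trans simon_sym by metis
    then show ?case
      using list_emb_Cons.IH[of p] insert[of p w a] 1 list_emb_Cons.prems by auto
  next
    case (list_emb_Cons2 x y u w)
    then show ?case
      using list_emb_Cons2.IH[of "p @ [x]"] by simp
  qed
  obtain w where w: "subseq u w" "subseq v w" "simon n u w"
    using simon_common_superword[OF sim] .
  have "set w \<subseteq> A"
    using simon_set[OF w(3)] assms(3,4) by simp
  moreover have "simon n v w"
    using sim w(3) simon_sym simon_trans by blast
  ultimately show ?thesis
    using chain[of u w "[]"] chain[of v w "[]"] w by simp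
qed

section \<open>Insertion of a single letter and its depths\<close>

text \<open>Take the largest \<open>k\<close> at which \<open>p\<close> absorbs \<open>a\<close>.
  Failure at depth \<open>k + 1\<close> on the left and at depth \<open>n - k\<close> on the right
  would give two halves that glue around the inserted \<open>a\<close> to a new subsequence of
  length at most \<open>n\<close>.\<close>

lemma simon_insertE:
  assumes "simon n (p @ q) (p @ a # q)"
  obtains k l where "k + l = n" "simon k p (p @ [a])" "simon l q (a # q)"
proof -
  let ?P = "\<lambda>k. k \<le> n \<and> simon k p (p @ [a])"
  define k where "k = (GREATEST k. ?P k)"
  have k: "?P k"
    unfolding k_def by (rule GreatestI_nat[of ?P 0 n]) auto
  have "simon (n - k) q (a # q)"
  proof (cases "k = n")
    case False
    have "\<not> ?P (Suc k)"
      using Greatest_le_nat[of ?P "Suc k" n] unfolding k_def by auto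
    then obtain x' where x': "length x' \<le> Suc k" "subseq x' (p @ a # [])" "\<not> subseq x' (p @ [])"
      using k False not_simon_insert[of "Suc k" p "[]" "[a]"] by auto
    obtain x z where "x' = x @ a # z" and x: "subseq x p" "\<not> subseq (x @ [a]) p"
      using subseq_insert_letterE[OF x'(2,3)] by metis
    with x' have x_len: "length x \<le> k" by simp
    show ?thesis
    proof (rule ccontr)
      assume "\<not> ?thesis"
      then obtain y' where y': "length y' \<le> n - k" "subseq y' ([] @ a # q)" "\<not> subseq y' ([] @ q)"
        using not_simon_insert[of "n - k" "[]" q "[a]"] by auto
      obtain z y where "y' = z @ a # y" and y: "subseq y q" "\<not> subseq (a # y) q"
        using subseq_insert_letterE[OF y'(2,3)] by metis
      with y' have y_len: "length y < n - k" by simp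
      have "subseq (x @ a # y) (p @ a # q)"
        using x y by (intro list_emb_append_mono) auto
      then have "subseq (x @ a # y) (p @ q)"
        using simonD[OF assms, of "x @ a # y"] x_len y_len by auto
      then show False
        using subseq_split_Cons x(2) y(2) by metis
    qed
  qed simp
  then show thesis
    using that[of k "n - k"] k by simp
qed

text \<open>Cut \<open>p\<close> at its last \<open>a\<close>. If \<open>x @ [c]\<close> were short
  and new to \<open>s\<close>, then \<open>x @ [c, a]\<close> would embed in \<open>p @ [a]\<close>,
  hence in \<open>p\<close>, where the final \<open>a\<close> is matched at the cut or earlier; so
  \<open>x @ [c]\<close> would embed in \<open>s\<close> after all. Trading one unit of depth for a
  shorter prefix drives the later recursions.\<close>

lemma simon_snocE:
  assumes "simon (Suc k) p (p @ [a])"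
  obtains s t where "p = s @ a # t" "a \<notin> set t" "\<And>c. c \<in> set (a # t) \<Longrightarrow> simon k s (s @ [c])"
proof -
  have "a \<in> set p"
    using simon_set[OF assms] by auto
  then obtain s t where st: "p = s @ a # t" "a \<notin> set t"
    by (meson split_list_last)
  have "simon k s (s @ [c])" if c: "c \<in> set (a # t)" for c
  proof (rule ccontr)
    assume "\<not> ?thesis"
    then obtain x' where x': "length x' \<le> k" "subseq x' (s @ c # [])" "\<not> subseq x' (s @ [])"
      using not_simon_insert[of k s "[]" "[c]"] by auto
    obtain x y where "x' = x @ c # y" and x: "subseq x s" "\<not> subseq (x @ [c]) s"
      using subseq_insert_letterE[OF x'(2,3)] by metis
    with x' have "length x < k" by simp
    have "subseq ((x @ [c]) @ [a]) (p @ [a])"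
      using x(1) c unfolding st(1)
      by (intro list_emb_append_mono) (auto simp: subseq_singleton_left)
    then have "subseq ((x @ [c]) @ [a]) p"
      using simonD[OF assms] \<open>length x < k\<close> by simp
    then have "subseq (x @ [c, a]) ((s @ [a]) @ t)"
      by (simp add: st(1))
    then have "subseq (x @ [c, a]) (s @ [a])"
      using subseq_split_Cons[of "x @ [c]" a "[]" "s @ [a]" t] st(2) subseq_singleton_left by fastforce
    then have "subseq ((x @ [c]) @ [a]) (s @ [a])"
      by simp
    then show False
      using x(2) subseq_append by blast
  qed
  then show thesis
    using that st by blast
qed

lemma simon_snoc_append:
  assumes "simon k s (s @ [c])" "simon k s (s @ t)"
  shows "simon k (s @ t) (s @ t @ [c])"
proof -
  have "simon k (s @ [c]) ((s @ t) @ [c])"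
    by (intro simon_append assms(2) simon_refl)
  then show ?thesis
    using simon_trans[OF simon_trans[OF simon_sym[OF assms(2)] assms(1)]] by simp
qed

lemma simon_absorb_letters:
  assumes "\<And>c. c \<in> set t \<Longrightarrow> simon k s (s @ [c])"
  shows "simon k s (s @ t)"
  using assms
proof (induction t rule: rev_induct)
  case (snoc c t)
  then show ?case
    using simon_snoc_append[of k s c t] simon_trans by fastforce
qed simp

lemma simon_rev: "simon n (rev u) (rev v) \<longleftrightarrow> simon n u v"
proof -
  have sr: "subseq w (rev u) \<longleftrightarrow> subseq (rev w) u" for w u :: "'a list"
  proof -
    have "subseq (rev w) (rev u)" if "subseq w u" for w u :: "'a list"
      using that by induction (auto intro: list_emb_append_mono subseq_rev_drop_many)
    from this[of w "rev u"] this[of "rev w" u] show ?thesis by auto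
  qed
  show ?thesis
    unfolding simon_def sr by (metis length_rev rev_rev_ident)
qed

section \<open>The stylic monoid\<close>

text \<open>The hypothesis \<open>collapse\<close> abstracts the two one-sided rules of the stylic monoid, in which
  a letter absorbs its recurrences across smaller letters to its right and across larger letters to
  its left. The rank of a letter bounds the depth of the recursion.\<close>

lemma absorb_letter:
  fixes \<psi> :: "'a list \<Rightarrow> 'b" and r :: "'a \<Rightarrow> nat"
  assumes cong: "\<And>p u v q. \<psi> u = \<psi> v \<Longrightarrow> \<psi> (p @ u @ q) = \<psi> (p @ v @ q)"
    and collapse: "\<And>a t. a \<in> A \<Longrightarrow> set t \<subseteq> A \<Longrightarrow> \<forall>c\<in>set t. r a < r c \<Longrightarrow> \<psi> (a # t @ [a]) = \<psi> (a # t)"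
    and inj: "inj_on r A" and pos: "\<And>a. a \<in> A \<Longrightarrow> 1 \<le> r a"
    and "simon k p (p @ [a])" "r a \<le> k" "set p \<subseteq> A" "a \<in> A"
  shows "\<psi> (p @ [a]) = \<psi> p"
  using assms(5-)
proof (induction k arbitrary: p a)
  case 0
  then show ?case using pos by force
next
  case (Suc k)
  obtain s t where st: "p = s @ a # t" "a \<notin> set t"
    and absorb: "\<And>c. c \<in> set (a # t) \<Longrightarrow> simon k s (s @ [c])"
    using simon_snocE[OF Suc.prems(1)] by metis
  define f where "f t = filter (\<lambda>c. r a < r c) t" for t
  \<comment> \<open>Letters of smaller rank than \<open>a\<close> may be dropped: the word before
    such a letter \<open>c\<close> absorbs it at depth \<open>k\<close>, and
    \<open>r c < r a \<le> Suc k\<close> lets the induction hypothesis apply. Only letters of larger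
    rank remain, across which \<open>collapse\<close> works.\<close>
  have low: "\<psi> (s @ a # t') = \<psi> (s @ a # f t')" if "set t' \<subseteq> set t" for t'
    using that
  proof (induction t' rule: rev_induct)
    case Nil
    then show ?case by (simp add: f_def)
  next
    case (snoc c t')
    have IH: "\<psi> (s @ a # t') = \<psi> (s @ a # f t')"
      using snoc by simp
    have c: "c \<in> A" "c \<noteq> a" "c \<in> set t"
      using snoc.prems Suc.prems(3) st by auto
    show ?case
    proof (cases "r a < r c")
      case True
      then show ?thesis
        using cong[OF IH, of "[]" "[c]"] by (simp add: f_def)
    next
      case False
      then have "r c < r a"
        using inj c Suc.prems(4) by (metis inj_onD linorder_neqE_nat)
      have "simon k s (s @ a # t')"
        by (rule simon_absorb_letters, rule absorb) (use snoc.prems in auto)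
      then have "simon k (s @ a # t') ((s @ a # t') @ [c])"
        using simon_snoc_append absorb[of c] c by fastforce
      then have "\<psi> ((s @ a # t') @ [c]) = \<psi> (s @ a # t')"
        by (rule Suc.IH) (use \<open>r c < r a\<close> Suc.prems snoc.prems st(1) c in auto)
      then show ?thesis
        using IH False by (simp add: f_def)
    qed
  qed
  have "\<psi> (a # f t @ [a]) = \<psi> (a # f t)"
    by (rule collapse) (use Suc.prems st in \<open>auto simp: f_def\<close>)
  from cong[OF this, of s "[]"] have "\<psi> (s @ a # f t @ [a]) = \<psi> (s @ a # f t)"
    by simp
  moreover have "\<psi> ((s @ a # t) @ [a]) = \<psi> ((s @ a # f t) @ [a])"
    using cong[OF low, of t "[]" "[a]"] by simp
  ultimately show ?case
    using low[of t] st(1) by simp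
qed

abbreviation stylic_congruence :: "nat \<Rightarrow> (nat list \<times> nat list) set" where
  "stylic_congruence n \<equiv> generated_congruence {1..n} (stylic_relations n)"

lemma generated_congruence_lists:
  assumes "(u, v) \<in> generated_congruence A R"
  shows "u \<in> lists A \<and> v \<in> lists A"
  using assms by induction auto

lemma generated_congruence_context:
  assumes "(u, v) \<in> generated_congruence A R" "p \<in> lists A" "q \<in> lists A"
  shows "(p @ u @ q, p @ v @ q) \<in> generated_congruence A R"
  using assms by (intro generated_congruence.mult generated_congruence.refl)

lemma equiv_generated_congruence: "equiv (lists A) (generated_congruence A R)"
proof (rule equivI)
  show "generated_congruence A R \<subseteq> lists A \<times> lists A"
    using generated_congruence_lists by fastforce
  show "refl_on (lists A) (generated_congruence A R)"
    using generated_congruence_lists by (fastforce intro: refl_onI generated_congruence.refl)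
  show "sym (generated_congruence A R)"
    by (meson symI generated_congruence.sym)
  show "trans (generated_congruence A R)"
    by (meson transI generated_congruence.trans)
qed

text \<open>Words outside \<open>lists A\<close> are related to nothing and have the empty image, so
  the class map is compatible with contexts on all words and can serve as
  \<open>\<psi>\<close>.\<close>

lemma generated_congruence_class_context:
  assumes "generated_congruence A R `` {u} = generated_congruence A R `` {v}"
  shows "generated_congruence A R `` {p @ u @ q} = generated_congruence A R `` {p @ v @ q}"
proof (cases "p @ u @ q \<in> lists A")
  case True
  then have lists: "p \<in> lists A" "u \<in> lists A" "q \<in> lists A"
    by auto
  have "u \<in> generated_congruence A R `` {v}"
    unfolding assms[symmetric] using generated_congruence.refl[OF lists(2)] by (rule ImageI) simp
  then have "(u, v) \<in> generated_congruence A R"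
    by (auto intro: generated_congruence.sym)
  then have "(p @ u @ q, p @ v @ q) \<in> generated_congruence A R"
    by (rule generated_congruence_context[OF _ lists(1,3)])
  then show ?thesis
    by (rule equiv_class_eq[OF equiv_generated_congruence])
next
  case False
  have empty: "generated_congruence A R `` {w} = {} \<longleftrightarrow> w \<notin> lists A" for w
    using generated_congruence_lists[of w _ A R] generated_congruence.refl[of w A R] by blast
  have "p @ v @ q \<notin> lists A"
    using False assms empty[of u] empty[of v] by auto
  then show ?thesis
    using False empty[of "p @ u @ q"] empty[of "p @ v @ q"] by blast
qed

lemma stylic_base:
  assumes "(u, v) \<in> stylic_relations n"
  shows "(u, v) \<in> stylic_congruence n"
  using assms by (intro generated_congruence.base) (auto simp: stylic_relations_def)

text \<open>A single letter \<open>b < a\<close> is crossed by \<open>aba = aab = ab\<close>, where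
  the first step is the relation \<open>bac = bca\<close> with its two larger letters equal. For
  longer \<open>t\<close> the induction hypothesis lends an \<open>a\<close> in front of the last
  letter and takes it back afterwards.\<close>

lemma stylic_collapse_left:
  assumes "a \<in> {1..n}" "set t \<subseteq> {1..<a}"
  shows "(a # t @ [a], a # t) \<in> stylic_congruence n"
  using assms(2)
proof (induction t rule: rev_induct)
  case Nil
  have "([a, a], [a]) \<in> stylic_congruence n"
    by (rule stylic_base) (use assms in \<open>auto simp: stylic_relations_def\<close>)
  then show ?case by simp
next
  case (snoc b t)
  then have b: "b \<in> {1..n}" "b < a" and t: "t \<in> lists {1..n}"
    using assms(1) by auto
  have IH: "(a # t @ [a], a # t) \<in> stylic_congruence n"
    using snoc by simp
  have 1: "([a, a], [a]) \<in> stylic_congruence n"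
    by (rule stylic_base) (use assms in \<open>auto simp: stylic_relations_def\<close>)
  have 2: "([a, b, a], [a, a, b]) \<in> stylic_congruence n"
    by (rule stylic_base) (use assms(1) b in \<open>auto simp: stylic_relations_def\<close>)
  have 3: "([a, b, a], [a, b]) \<in> stylic_congruence n"
    using generated_congruence.trans[OF 2]
      generated_congruence_context[OF 1, of "[]" "[b]"] b by simp
  have 4: "(a # t @ [a, b, a], a # t @ [b, a]) \<in> stylic_congruence n"
    using generated_congruence_context[OF IH, of "[]" "[b, a]"] assms(1) b by simp
  have 5: "(a # t @ [a, b], a # t @ [b]) \<in> stylic_congruence n"
    using generated_congruence_context[OF IH, of "[]" "[b]"] assms(1) b by simp
  have 6: "(a # t @ [a, b, a], a # t @ [a, b]) \<in> stylic_congruence n"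
    using generated_congruence_context[OF 3, of "a # t" "[]"] assms(1) t by simp
  show ?case
    using generated_congruence.trans[OF generated_congruence.sym[OF 4]
        generated_congruence.trans[OF 6 5]] by simp
qed

text \<open>Dual to the previous lemma: \<open>aba = baa = ba\<close> for \<open>a < b\<close>, now
  by the relation \<open>acb = cab\<close> with its two smaller letters equal.\<close>

lemma stylic_collapse_right:
  assumes "a \<in> {1..n}" "set t \<subseteq> {a<..n}"
  shows "(a # t @ [a], t @ [a]) \<in> stylic_congruence n"
  using assms(2)
proof (induction t)
  case Nil
  have "([a, a], [a]) \<in> stylic_congruence n"
    by (rule stylic_base) (use assms in \<open>auto simp: stylic_relations_def\<close>)
  then show ?case by simp
next
  case (Cons b t)
  then have b: "b \<in> {1..n}" "a < b" and t: "t \<in> lists {1..n}"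
    using assms(1) by auto
  have IH: "(a # t @ [a], t @ [a]) \<in> stylic_congruence n"
    using Cons by simp
  have 1: "([a, a], [a]) \<in> stylic_congruence n"
    by (rule stylic_base) (use assms in \<open>auto simp: stylic_relations_def\<close>)
  have 2: "([a, b, a], [b, a, a]) \<in> stylic_congruence n"
    by (rule stylic_base) (use assms(1) b in \<open>auto simp: stylic_relations_def\<close>)
  have 3: "([a, b, a], [b, a]) \<in> stylic_congruence n"
    using generated_congruence.trans[OF 2]
      generated_congruence_context[OF 1, of "[b]" "[]"] b by simp
  have 4: "(a # b # a # t @ [a], a # b # t @ [a]) \<in> stylic_congruence n"
    using generated_congruence_context[OF IH, of "[a, b]" "[]"] assms(1) b by simp
  have 5: "(b # a # t @ [a], b # t @ [a]) \<in> stylic_congruence n"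
    using generated_congruence_context[OF IH, of "[b]" "[]"] assms(1) b by simp
  have 6: "(a # b # a # t @ [a], b # a # t @ [a]) \<in> stylic_congruence n"
    using generated_congruence_context[OF 3, of "[]" "t @ [a]"] assms(1) t by simp
  show ?case
    using generated_congruence.trans[OF generated_congruence.sym[OF 4]
        generated_congruence.trans[OF 6 5]] by simp
qed

lemma simon_imp_stylic:
  assumes "simon n u v" "n \<ge> 1" "u \<in> lists {1..n}" "v \<in> lists {1..n}"
  shows "(u, v) \<in> stylic_congruence n"
proof -
  define \<psi> where "\<psi> w = stylic_congruence n `` {w}" for w
  have cong: "\<psi> (p @ u @ q) = \<psi> (p @ v @ q)" if "\<psi> u = \<psi> v" for p u v q
    using that generated_congruence_class_context unfolding \<psi>_def by metis
  have \<psi>I: "\<psi> u = \<psi> v" if "(u, v) \<in> stylic_congruence n" for u v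
    unfolding \<psi>_def by (rule equiv_class_eq[OF equiv_generated_congruence that])
  have "\<psi> u = \<psi> v"
  proof (rule simon_imp_eq[where A = "{1..n}", OF _ assms(1,2)])
    fix p q a
    assume sim: "simon n (p @ q) (p @ a # q)" and sub: "set (p @ q) \<subseteq> {1..n}"
    have a: "a \<in> {1..n}"
      using simon_set[OF sim assms(2)] sub by (metis in_set_conv_decomp set_append subsetD)
    obtain k l where kl: "k + l = n" "simon k p (p @ [a])" "simon l q (a # q)"
      using simon_insertE[OF sim] .
    show "\<psi> (p @ a # q) = \<psi> (p @ q)"
    proof (cases "n + 1 - a \<le> k")
      case True
      \<comment> \<open>On the left, collapsing runs across smaller letters whereas
        \<open>absorb_letter\<close> asks for larger rank, so the rank reverses the order. On the
        right, after reversal, the rank is the letter itself.\<close>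
      have "\<psi> (p @ [a]) = \<psi> p"
      proof (rule absorb_letter[where r = "\<lambda>a. n + 1 - a" and A = "{1..n}" and k = k])
        show "\<psi> (p @ u @ q) = \<psi> (p @ v @ q)" if "\<psi> u = \<psi> v" for p u v q
          by (rule cong[OF that])
        fix a t
        assume "a \<in> {1..n}" "set t \<subseteq> {1..n}" "\<forall>c\<in>set t. n + 1 - a < n + 1 - c"
        then show "\<psi> (a # t @ [a]) = \<psi> (a # t)"
          by (intro \<psi>I stylic_collapse_left) force+
      qed (use True sub a kl(2) in \<open>auto intro!: inj_onI\<close>)
      then show ?thesis
        using cong[of "p @ [a]" p "[]" q] by simp
    next
      case False
      then have "a \<le> l"
        using kl(1) a by auto
      define \<phi> where "\<phi> w = \<psi> (rev w)" for w
      have "\<phi> (rev q @ [a]) = \<phi> (rev q)"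
      proof (rule absorb_letter[where r = id and A = "{1..n}" and k = l])
        show "\<phi> (p @ u @ q) = \<phi> (p @ v @ q)" if "\<phi> u = \<phi> v" for p u v q
          using cong[OF that[unfolded \<phi>_def], of "rev q" "rev p"] by (simp add: \<phi>_def)
        fix a t
        assume "a \<in> {1..n}" "set t \<subseteq> {1..n}" "\<forall>c\<in>set t. id a < id c"
        then have "\<psi> (a # rev t @ [a]) = \<psi> (rev t @ [a])"
          by (intro \<psi>I stylic_collapse_right) force+
        then show "\<phi> (a # t @ [a]) = \<phi> (a # t)"
          by (simp add: \<phi>_def)
      next
        show "simon l (rev q) (rev q @ [a])"
          using kl(3) simon_rev[of l q "a # q"] by simp
      qed (use \<open>a \<le> l\<close> sub a in auto)
      then show ?thesis
        using cong[of "a # q" q p "[]"] by (simp add: \<phi>_def)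
    qed
  qed (use assms in auto)
  then show ?thesis
    using eq_equiv_class[OF _ equiv_generated_congruence assms(4)] unfolding \<psi>_def by blast
qed

section \<open>Staircases as invariants of the stylic congruence\<close>

abbreviation staircase :: "nat list \<Rightarrow> bool" where
  "staircase \<equiv> successively (\<lambda>x y. x = Suc y)"

text \<open>Steps of exactly one are what the relations respect. The pair \<open>ca\<close> of
  \<open>cab\<close> is missing from \<open>acb\<close> in general, but \<open>c = a + 1\<close>
  forces \<open>b = a\<close>, and then \<open>cb\<close> is the same pair. For
  \<open>bac = bca\<close> it forces \<open>b = c\<close>, and \<open>ba\<close> replaces
  \<open>ca\<close>. Products are harmless because the factors of a staircase are
  staircases.\<close>

lemma stylic_staircase:
  assumes "(u, v) \<in> stylic_congruence n" "staircase w"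
  shows "subseq w u \<longleftrightarrow> subseq w v"
  using assms
proof (induction arbitrary: w)
  case (base u v)
  consider "w = []" | x where "w = [x]" | x y where "w = [x, y]" | x y z w' where "w = x # y # z # w'"
    by (metis list.exhaust)
  then show ?case
    using base by cases (auto simp: stylic_relations_def subseq_singleton_left split: if_splits)
next
  case (mult u v u' v')
  show ?case
    unfolding subseq_append_iff
    using mult.IH mult.prems successively_append_iff by metis
qed auto

lemma staircase_rev_upt: "staircase (rev [i..<j])"
proof (induction j)
  case (Suc j)
  then show ?case
    by (cases "i < j") (auto simp: successively_Cons hd_rev)
qed simp

text \<open>The \<open>i\<close>th letter from the right of \<open>w\<close> is encoded by \<open>i\<close>. Each letter is sent to an
  increasing word, so that a decreasing subsequence uses at most one letter of each image.\<close>

definition staircase_subst :: "nat list \<Rightarrow> nat \<Rightarrow> nat list" where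
  "staircase_subst w x = filter (\<lambda>j. w ! (length w - j) = x) [1..<Suc (length w)]"

lemma subseq_decreasing_step:
  fixes s :: "'a::linorder list"
  assumes "sorted_wrt (<) s" "sorted_wrt (>) (m # w)"
  shows "subseq (m # w) (s @ t) \<longleftrightarrow> (if m \<in> set s then subseq w t else subseq (m # w) t)"
  using assms(1)
proof (induction s)
  case (Cons c s)
  show ?case
  proof (cases "c = m")
    case True
    have "subseq w (s @ t) \<longleftrightarrow> subseq w t"
    proof (cases w)
      case w: (Cons d w')
      have "d < m" "\<forall>e\<in>set s. m < e"
        using Cons.prems assms(2) True w by auto
      then have "\<forall>e\<in>set s. d < e"
        by (meson order.strict_trans)
      then show ?thesis
        unfolding w by (induction s) auto
    qed simp
    then show ?thesis
      using True by simp
  next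
    case False
    then show ?thesis
      using Cons by auto
  qed
qed simp

lemma staircase_subst_subseq:
  "subseq (rev [1..<Suc (length w)]) (concat (map (staircase_subst w) u)) \<longleftrightarrow> subseq w u"
proof -
  \<comment> \<open>The generalization keeps only the last \<open>m\<close> letters of
    \<open>w\<close>, whose codes are \<open>m\<close> down to \<open>1\<close>. Reading a letter of
    \<open>u\<close> either matches the code \<open>m\<close> and lowers it by one, or changes
    nothing.\<close>
  have "subseq (rev [1..<Suc m]) (concat (map (staircase_subst w) u)) \<longleftrightarrow> subseq (drop (length w - m) w) u"
    if "m \<le> length w" for m
    using that
  proof (induction u arbitrary: m)
    case Nil
    then show ?case by (cases m) auto
  next
    case (Cons x u)
    show ?case
    proof (cases m)
      case 0
      then show ?thesis by simp
    next
      case (Suc m')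
      have "drop (length w - m) w = w ! (length w - m) # drop (length w - m') w"
        using Cons.prems Suc by (metis Cons_nth_drop_Suc Suc_diff_Suc Suc_le_lessD diff_less
            less_le_trans zero_less_Suc)
      moreover have "m \<in> set (staircase_subst w x) \<longleftrightarrow> w ! (length w - m) = x"
        using Cons.prems Suc by (auto simp: staircase_subst_def simp del: upt_Suc)
      moreover have "subseq (m # rev [1..<Suc m']) (staircase_subst w x @ concat (map (staircase_subst w) u)) \<longleftrightarrow>
        (if m \<in> set (staircase_subst w x) then subseq (rev [1..<Suc m']) (concat (map (staircase_subst w) u))
         else subseq (m # rev [1..<Suc m']) (concat (map (staircase_subst w) u)))"
        by (rule subseq_decreasing_step)
          (auto simp: staircase_subst_def Suc sorted_wrt_rev intro!: sorted_wrt_filter simp del: upt_Suc)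
      ultimately show ?thesis
        using Cons.IH[of m] Cons.IH[of m'] Cons.prems Suc by auto
    qed
  qed
  from this[of "length w"] show ?thesis by simp
qed

section \<open>Values of words in monoids\<close>

definition word_value :: "('a, 'c) monoid_scheme \<Rightarrow> ('x \<Rightarrow> 'a) \<Rightarrow> 'x list \<Rightarrow> 'a" where
  "word_value M \<theta> w = foldr (\<lambda>x m. \<theta> x \<otimes>\<^bsub>M\<^esub> m) w \<one>\<^bsub>M\<^esub>"

lemma word_value_Nil [simp]: "word_value M \<theta> [] = \<one>\<^bsub>M\<^esub>"
  and word_value_Cons [simp]: "word_value M \<theta> (x # w) = \<theta> x \<otimes>\<^bsub>M\<^esub> word_value M \<theta> w"
  by (simp_all add: word_value_def)

lemma word_value_cong:
  "(\<And>x. x \<in> set w \<Longrightarrow> \<theta> x = \<eta> x) \<Longrightarrow> word_value M \<theta> w = word_value M \<eta> w"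
  by (induction w) auto

lemma word_value_map: "word_value M \<theta> (map f w) = word_value M (\<theta> \<circ> f) w"
  by (induction w) auto

context monoid
begin

lemma word_value_closed:
  "(\<And>x. x \<in> set w \<Longrightarrow> \<theta> x \<in> carrier G) \<Longrightarrow> word_value G \<theta> w \<in> carrier G"
  by (induction w) auto

lemma word_value_append:
  assumes "\<And>x. x \<in> set (u @ v) \<Longrightarrow> \<theta> x \<in> carrier G"
  shows "word_value G \<theta> (u @ v) = word_value G \<theta> u \<otimes> word_value G \<theta> v"
  using assms by (induction u) (auto simp: word_value_closed m_assoc)

lemma word_value_hom:
  assumes "\<And>x. x \<in> set w \<Longrightarrow> \<theta> x \<in> carrier G" "h \<in> hom G H" "h \<one> = \<one>\<^bsub>H\<^esub>"
  shows "h (word_value G \<theta> w) = word_value H (h \<circ> \<theta>) w"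
  using assms(1) by (induction w) (use assms(2,3) in \<open>auto simp: hom_def word_value_closed\<close>)

lemma satisfies_iff_word_value:
  "satisfies G e \<longleftrightarrow> (\<forall>\<theta>. range \<theta> \<subseteq> carrier G \<longrightarrow> word_value G \<theta> (fst e) = word_value G \<theta> (snd e))"
proof (intro iffI allI impI)
  fix \<theta> :: "nat \<Rightarrow> 'a"
  assume "satisfies G e" "range \<theta> \<subseteq> carrier G"
  moreover have "word_value G \<theta> \<in> hom (free_monoid UNIV) G"
    using calculation(2)
    by (intro homI) (auto simp: free_monoid_def image_subset_iff intro!: word_value_closed word_value_append)
  ultimately show "word_value G \<theta> (fst e) = word_value G \<theta> (snd e)"
    unfolding satisfies_def by simp
next
  assume all: "\<forall>\<theta>. range \<theta> \<subseteq> carrier G \<longrightarrow> word_value G \<theta> (fst e) = word_value G \<theta> (snd e)"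
  show "satisfies G e"
    unfolding satisfies_def
  proof (intro ballI impI)
    fix \<psi> :: "nat list \<Rightarrow> 'a"
    assume \<psi>: "\<psi> \<in> hom (free_monoid UNIV) G" "\<psi> [] = \<one>"
    have range: "\<psi> w \<in> carrier G" for w
      using \<psi>(1) by (auto simp: hom_def free_monoid_def)
    have "\<psi> w = word_value G (\<lambda>x. \<psi> [x]) w" for w
    proof (induction w)
      case (Cons x w)
      have "\<psi> ([x] @ w) = \<psi> [x] \<otimes> \<psi> w"
        using \<psi>(1) unfolding hom_def free_monoid_def by (simp del: append_Cons append_Nil)
      with Cons show ?case by simp
    qed (simp add: \<psi>)
    then show "\<psi> (fst e) = \<psi> (snd e)"
      using all range by (metis (no_types, lifting) image_subsetI)
  qed
qed

end

text \<open>Membership in \<open>hom\<close> does not include preservation of the unit. For a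
  surjective map it follows by multiplying the image of the unit with a preimage \<open>m\<close> of
  the unit of \<open>N\<close>.\<close>

lemma epi_one:
  assumes "monoid M" "monoid N" "f \<in> epi M N"
  shows "f \<one>\<^bsub>M\<^esub> = \<one>\<^bsub>N\<^esub>"
proof -
  interpret M: monoid M by fact
  interpret N: monoid N by fact
  have "\<one>\<^bsub>N\<^esub> \<in> f ` carrier M"
    using assms(3) by (simp add: epi_def)
  then obtain m where m: "m \<in> carrier M" "f m = \<one>\<^bsub>N\<^esub>"
    by (auto simp del: N.one_closed)
  have "\<forall>x\<in>carrier M. \<forall>y\<in>carrier M. f (x \<otimes>\<^bsub>M\<^esub> y) = f x \<otimes>\<^bsub>N\<^esub> f y"
    using assms(3) by (simp add: epi_def hom_def)
  then have "f (\<one>\<^bsub>M\<^esub> \<otimes>\<^bsub>M\<^esub> m) = f \<one>\<^bsub>M\<^esub> \<otimes>\<^bsub>N\<^esub> f m"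
    using m(1) M.one_closed by blast
  moreover have "f \<one>\<^bsub>M\<^esub> \<in> carrier N"
    using assms(3) by (auto simp: epi_def)
  ultimately show ?thesis
    using m by simp
qed

lemma iso_imp_epi: "h \<in> iso M N \<Longrightarrow> h \<in> epi M N"
  by (simp add: iso_iff_mon_epi)

lemma satisfies_epi:
  assumes "monoid M" "monoid N" "f \<in> epi M N" "satisfies M e"
  shows "satisfies N e"
proof -
  interpret M: monoid M by fact
  interpret N: monoid N by fact
  show ?thesis
    unfolding N.satisfies_iff_word_value
  proof (intro allI impI)
    fix \<theta> :: "nat \<Rightarrow> _"
    assume "range \<theta> \<subseteq> carrier N"
    then have "\<forall>x. \<exists>m. m \<in> carrier M \<and> f m = \<theta> x"
      using assms(3) unfolding epi_def by (auto simp: image_iff set_eq_iff) (metis rangeI subsetD)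
    then obtain \<eta> where \<eta>: "\<And>x. \<eta> x \<in> carrier M" "\<And>x. f (\<eta> x) = \<theta> x"
      by metis
    have "f (word_value M \<eta> w) = word_value N \<theta> w" for w
      using M.word_value_hom[of w \<eta> f N] epi_one[OF assms(1-3)] \<eta> assms(3)
      by (simp add: epi_def comp_def)
    moreover have "word_value M \<eta> (fst e) = word_value M \<eta> (snd e)"
      using assms(4) \<eta>(1) unfolding M.satisfies_iff_word_value by blast
    ultimately show "word_value N \<theta> (fst e) = word_value N \<theta> (snd e)"
      by metis
  qed
qed

lemma satisfies_mon:
  assumes "monoid M" "monoid N" "f \<in> mon M N" "f \<one>\<^bsub>M\<^esub> = \<one>\<^bsub>N\<^esub>" "satisfies N e"
  shows "satisfies M e"
proof -
  interpret M: monoid M by fact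
  interpret N: monoid N by fact
  have f: "f \<in> hom M N" "inj_on f (carrier M)"
    using assms(3) by (auto simp: mon_def)
  show ?thesis
    unfolding M.satisfies_iff_word_value
  proof (intro allI impI)
    fix \<theta> :: "nat \<Rightarrow> 'a"
    assume \<theta>: "range \<theta> \<subseteq> carrier M"
    have "f (word_value M \<theta> w) = word_value N (f \<circ> \<theta>) w" for w
      using \<theta> by (intro M.word_value_hom f assms(4)) auto
    moreover have "range (f \<circ> \<theta>) \<subseteq> carrier N"
      using \<theta> f(1) by (auto simp: hom_def)
    ultimately have "f (word_value M \<theta> (fst e)) = f (word_value M \<theta> (snd e))"
      using assms(5) unfolding N.satisfies_iff_word_value by metis
    then show "word_value M \<theta> (fst e) = word_value M \<theta> (snd e)"
      using inj_onD[OF f(2)] \<theta> by (meson M.word_value_closed rangeI subsetD)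
  qed
qed

lemma satisfies_copies:
  assumes "monoid M" "N \<in> copies M"
  shows "satisfies N e \<longleftrightarrow> satisfies M e"
proof -
  obtain h where h: "h \<in> iso N M" and "monoid N"
    using assms(2) by (auto simp: copies_def is_iso_def)
  then show ?thesis
    using satisfies_epi[of N M h e] satisfies_mon[of N M h e] epi_one[of N M h] assms(1)
    by (auto simp: iso_iff_mon_epi)
qed

lemma monoid_product_group:
  assumes "\<And>i. i \<in> I \<Longrightarrow> monoid (M i)"
  shows "monoid (product_group I M)"
proof (rule monoidI)
  fix x y z
  assume "x \<in> carrier (product_group I M)" "y \<in> carrier (product_group I M)"
    "z \<in> carrier (product_group I M)"
  then show "x \<otimes>\<^bsub>product_group I M\<^esub> y \<otimes>\<^bsub>product_group I M\<^esub> z =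
      x \<otimes>\<^bsub>product_group I M\<^esub> (y \<otimes>\<^bsub>product_group I M\<^esub> z)"
    using assms by (auto simp: PiE_iff monoid.m_assoc intro!: restrict_ext)
next
  fix x assume x: "x \<in> carrier (product_group I M)"
  have "(\<lambda>i\<in>I. \<one>\<^bsub>M i\<^esub> \<otimes>\<^bsub>M i\<^esub> x i) = x" "(\<lambda>i\<in>I. x i \<otimes>\<^bsub>M i\<^esub> \<one>\<^bsub>M i\<^esub>) = x"
    using x assms by (auto simp: PiE_iff monoid.l_one monoid.r_one intro!: extensionalityI[of _ I])
  moreover have "(\<lambda>i\<in>I. (\<lambda>i\<in>I. \<one>\<^bsub>M i\<^esub>) i \<otimes>\<^bsub>M i\<^esub> x i) = (\<lambda>i\<in>I. \<one>\<^bsub>M i\<^esub> \<otimes>\<^bsub>M i\<^esub> x i)"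
    "(\<lambda>i\<in>I. x i \<otimes>\<^bsub>M i\<^esub> (\<lambda>i\<in>I. \<one>\<^bsub>M i\<^esub>) i) = (\<lambda>i\<in>I. x i \<otimes>\<^bsub>M i\<^esub> \<one>\<^bsub>M i\<^esub>)"
    by (rule restrict_ext, simp)+
  ultimately show "\<one>\<^bsub>product_group I M\<^esub> \<otimes>\<^bsub>product_group I M\<^esub> x = x"
    "x \<otimes>\<^bsub>product_group I M\<^esub> \<one>\<^bsub>product_group I M\<^esub> = x"
    unfolding mult_product_group one_product_group by presburger+
next
  show "x \<otimes>\<^bsub>product_group I M\<^esub> y \<in> carrier (product_group I M)"
    if "x \<in> carrier (product_group I M)" "y \<in> carrier (product_group I M)" for x y
    using that assms by (auto simp: PiE_iff intro!: monoid.m_closed)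
  show "\<one>\<^bsub>product_group I M\<^esub> \<in> carrier (product_group I M)"
    using assms by (auto intro: monoid.one_closed)
qed

lemma word_value_product:
  "word_value (product_group I M) (\<lambda>x. \<lambda>i\<in>I. \<theta> i x) w = (\<lambda>i\<in>I. word_value (M i) (\<theta> i) w)"
proof (induction w)
  case (Cons x w)
  show ?case
    unfolding word_value_Cons Cons mult_product_group by (rule restrict_ext) simp
qed simp

section \<open>Division, and closure of (pseudo)varieties under it\<close>

text \<open>The values of words under \<open>\<theta>\<close> form the submonoid \<open>S\<close>,
  and the value under \<open>\<theta>\<close> is sent to the value under \<open>\<eta>\<close>;
  \<open>ker\<close> is the well-definedness of this map.\<close>

lemma hom_image_division:
  assumes "monoid M" "monoid N"
    and \<theta>: "\<And>x. x \<in> G \<Longrightarrow> \<theta> x \<in> carrier M"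
    and \<eta>: "\<And>x. x \<in> G \<Longrightarrow> \<eta> x \<in> carrier N" "carrier N \<subseteq> word_value N \<eta> ` lists G"
    and ker: "\<And>u v. u \<in> lists G \<Longrightarrow> v \<in> lists G \<Longrightarrow>
      word_value M \<theta> u = word_value M \<theta> v \<Longrightarrow> word_value N \<eta> u = word_value N \<eta> v"
  obtains S f where "submonoid S M" "f \<in> epi (M\<lparr>carrier := S\<rparr>) N"
proof -
  interpret M: monoid M by fact
  interpret N: monoid N by fact
  define S where "S = word_value M \<theta> ` lists G"
  define f where "f s = word_value N \<eta> (SOME w. w \<in> lists G \<and> word_value M \<theta> w = s)" for s
  have f: "f (word_value M \<theta> w) = word_value N \<eta> w" if "w \<in> lists G" for w
  proof -
    let ?w = "SOME v. v \<in> lists G \<and> word_value M \<theta> v = word_value M \<theta> w"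
    have "?w \<in> lists G \<and> word_value M \<theta> ?w = word_value M \<theta> w"
      using that by (rule someI[of _ w, OF conjI]) simp
    then show ?thesis
      using ker that unfolding f_def by blast
  qed
  have append: "word_value M \<theta> (u @ v) = word_value M \<theta> u \<otimes>\<^bsub>M\<^esub> word_value M \<theta> v"
    "word_value N \<eta> (u @ v) = word_value N \<eta> u \<otimes>\<^bsub>N\<^esub> word_value N \<eta> v"
    if "u \<in> lists G" "v \<in> lists G" for u v
    using that \<theta> \<eta>(1) by (auto intro!: M.word_value_append N.word_value_append)
  have carrier: "carrier (M\<lparr>carrier := S\<rparr>) = S"
    by simp
  have "submonoid S M"
  proof
    show "S \<subseteq> carrier M"
      using \<theta> by (auto simp: S_def intro!: M.word_value_closed)
    show "\<one>\<^bsub>M\<^esub> \<in> S"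
      unfolding S_def by (rule image_eqI[of _ _ "[]"]) auto
    fix x y assume "x \<in> S" "y \<in> S"
    then obtain u v where "u \<in> lists G" "v \<in> lists G" "x = word_value M \<theta> u" "y = word_value M \<theta> v"
      by (auto simp only: S_def)
    then show "x \<otimes>\<^bsub>M\<^esub> y \<in> S"
      using append(1)[of u v] unfolding S_def by (metis append_in_lists_conv image_eqI)
  qed
  moreover have "f \<in> epi (M\<lparr>carrier := S\<rparr>) N"
    unfolding epi_iff_subset
  proof
    show "f \<in> hom (M\<lparr>carrier := S\<rparr>) N"
    proof (rule homI)
      show "f x \<in> carrier N" if x: "x \<in> carrier (M\<lparr>carrier := S\<rparr>)" for x
      proof -
        obtain w where "x = word_value M \<theta> w" "w \<in> lists G"
          using x unfolding carrier unfolding S_def by (rule imageE)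
        then show ?thesis
          using f[of w] \<eta>(1) by (auto intro!: N.word_value_closed)
      qed
      fix x y assume "x \<in> carrier (M\<lparr>carrier := S\<rparr>)" "y \<in> carrier (M\<lparr>carrier := S\<rparr>)"
      then obtain u v where "x = word_value M \<theta> u" "u \<in> lists G" "y = word_value M \<theta> v" "v \<in> lists G"
        unfolding carrier unfolding S_def by (elim imageE)
      then show "f (x \<otimes>\<^bsub>M\<lparr>carrier := S\<rparr>\<^esub> y) = f x \<otimes>\<^bsub>N\<^esub> f y"
        using f[of "u @ v"] f append by simp
    qed
    show "carrier N \<subseteq> f ` carrier (M\<lparr>carrier := S\<rparr>)"
    proof
      fix y assume "y \<in> carrier N"
      then have "y \<in> word_value N \<eta> ` lists G"
        by (rule subsetD[OF \<eta>(2)])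
      then obtain w where "y = word_value N \<eta> w" "w \<in> lists G"
        by (rule imageE)
      then show "y \<in> f ` carrier (M\<lparr>carrier := S\<rparr>)"
        unfolding carrier unfolding S_def using f[of w] by (metis image_eqI)
    qed
  qed
  ultimately show thesis
    using that by blast
qed

lemma variety_division:
  fixes K :: "'u monoid set" and I :: "('u \<Rightarrow> 'u) set"
  assumes K: "variety K" "\<And>i. i \<in> I \<Longrightarrow> M i \<in> K" and "monoid N"
    and \<theta>: "\<And>i x. i \<in> I \<Longrightarrow> x \<in> G \<Longrightarrow> \<theta> i x \<in> carrier (M i)"
    and \<eta>: "\<And>x. x \<in> G \<Longrightarrow> \<eta> x \<in> carrier N" "carrier N \<subseteq> word_value N \<eta> ` lists G"
    and ker: "\<And>u v. u \<in> lists G \<Longrightarrow> v \<in> lists G \<Longrightarrow>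
      (\<And>i. i \<in> I \<Longrightarrow> word_value (M i) (\<theta> i) u = word_value (M i) (\<theta> i) v) \<Longrightarrow>
      word_value N \<eta> u = word_value N \<eta> v"
  shows "N \<in> K"
proof -
  have "monoid (product_group I M)"
    using K unfolding variety_def by (intro monoid_product_group) blast
  then obtain S f where "submonoid S (product_group I M)" "f \<in> epi ((product_group I M)\<lparr>carrier := S\<rparr>) N"
  proof (rule hom_image_division[OF _ \<open>monoid N\<close> _ \<eta>])
    show "(\<lambda>i\<in>I. \<theta> i x) \<in> carrier (product_group I M)" if "x \<in> G" for x
      using \<theta> that by auto
    show "word_value N \<eta> u = word_value N \<eta> v"
      if "u \<in> lists G" "v \<in> lists G"
        "word_value (product_group I M) (\<lambda>x. \<lambda>i\<in>I. \<theta> i x) u = word_value (product_group I M) (\<lambda>x. \<lambda>i\<in>I. \<theta> i x) v"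
      for u v
    proof (rule ker[OF that(1,2)])
      fix i assume "i \<in> I"
      then show "word_value (M i) (\<theta> i) u = word_value (M i) (\<theta> i) v"
        using fun_cong[OF that(3)[unfolded word_value_product], of i] by simp
    qed
  qed
  then show ?thesis
    using K \<open>monoid N\<close> unfolding variety_def by blast
qed

lemma finite_copyE:
  fixes M :: "('a, 'c) monoid_scheme"
  assumes "monoid M" "finite (carrier M)"
  obtains N :: "'u::infinite monoid" where "N \<in> copies M"
proof -
  interpret monoid M by fact
  obtain f :: "'a \<Rightarrow> 'u" where f: "inj_on f (carrier M)"
    using arb_inj_on_finite_infinite[OF assms(2)] by blast
  define g where "g = inv_into (carrier M) f"
  have g: "g (f x) = x" if "x \<in> carrier M" for x
    using f that by (simp add: g_def)
  define N where "N = \<lparr>carrier = f ` carrier M, monoid.mult = (\<lambda>x y. f (g x \<otimes>\<^bsub>M\<^esub> g y)), one = f \<one>\<^bsub>M\<^esub>\<rparr>"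
  have "monoid N"
    by (rule monoidI) (auto simp: N_def g m_assoc)
  moreover have "g \<in> iso N M"
    unfolding iso_iff
  proof (intro conjI homI)
    show "g ` carrier N = carrier M" "inj_on g (carrier N)"
      by (force simp: N_def g image_image inj_on_def)+
  qed (auto simp: N_def g)
  ultimately show thesis
    using that is_isoI unfolding copies_def by blast
qed

lemma finite_copies: "N \<in> copies M \<Longrightarrow> finite (carrier N) \<longleftrightarrow> finite (carrier M)"
  using iso_finite by (auto simp: copies_def)

text \<open>The product of the \<open>M i\<close> lives in a function type, and
  \<open>pseudovariety\<close> speaks of index sets of natural numbers. Hence \<open>I\<close> is
  renumbered by \<open>b\<close>, and the product is replaced by a copy \<open>Q\<close> in the
  universe before submonoid and image are taken.\<close>

lemma pseudovariety_division:
  fixes K :: "'u::infinite monoid set" and I :: "'i set"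
  assumes K: "pseudovariety K" "\<And>i. i \<in> I \<Longrightarrow> M i \<in> K" and "finite I" and "monoid N"
    and \<theta>: "\<And>i x. i \<in> I \<Longrightarrow> x \<in> G \<Longrightarrow> \<theta> i x \<in> carrier (M i)"
    and \<eta>: "\<And>x. x \<in> G \<Longrightarrow> \<eta> x \<in> carrier N" "carrier N \<subseteq> word_value N \<eta> ` lists G"
    and ker: "\<And>u v. u \<in> lists G \<Longrightarrow> v \<in> lists G \<Longrightarrow>
      (\<And>i. i \<in> I \<Longrightarrow> word_value (M i) (\<theta> i) u = word_value (M i) (\<theta> i) v) \<Longrightarrow>
      word_value N \<eta> u = word_value N \<eta> v"
  shows "N \<in> K"
proof -
  obtain b where b: "bij_betw b {0..<card I} I"
    using ex_bij_betw_nat_finite[OF \<open>finite I\<close>] by blast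
  have bI: "b j \<in> I" if "j < card I" for j
    using b that by (auto simp: bij_betw_def)
  define P where "P = product_group {0..<card I} (M \<circ> b)"
  have mon: "monoid (M i)" "finite (carrier (M i))" if "i \<in> I" for i
  proof -
    have "\<forall>N\<in>K. monoid N \<and> finite (carrier N)"
      using K(1) unfolding pseudovariety_def by (rule conjunct1)
    then show "monoid (M i)" "finite (carrier (M i))"
      using K(2)[OF that] by auto
  qed
  have "monoid P"
    unfolding P_def by (rule monoid_product_group) (use bI mon in auto)
  moreover have "finite (carrier P)"
    unfolding P_def by (auto intro!: finite_PiE simp: bI mon)
  ultimately obtain Q :: "'u monoid" where Q: "Q \<in> copies P"
    using finite_copyE by blast
  then obtain h where "monoid Q" "Q \<cong> P" and h: "h \<in> iso Q P"
    by (auto simp: copies_def is_iso_def)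
  interpret Q: monoid Q by fact
  have "Q \<in> K"
  proof -
    have "finite {0..<card I} \<and> (\<forall>j\<in>{0..<card I}. (M \<circ> b) j \<in> K) \<and> monoid Q \<and>
        Q \<cong> product_group {0..<card I} (M \<circ> b)"
      using \<open>monoid Q\<close> \<open>Q \<cong> P\<close> K(2) bI by (simp add: P_def)
    then show ?thesis
      using K(1) unfolding pseudovariety_def by blast
  qed
  define \<kappa> where "\<kappa> x = (\<lambda>j\<in>{0..<card I}. \<theta> (b j) x)" for x
  have \<kappa>: "\<kappa> x \<in> carrier P" if "x \<in> G" for x
    using \<theta> bI that by (auto simp: P_def \<kappa>_def)
  define \<xi> where "\<xi> x = inv_into (carrier Q) h (\<kappa> x)" for x
  have \<xi>: "\<xi> x \<in> carrier Q" "h (\<xi> x) = \<kappa> x" if "x \<in> G" for x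
    using \<kappa>[OF that] h unfolding iso_iff \<xi>_def by (auto intro: inv_into_into f_inv_into_f)
  obtain S f where S: "submonoid S Q" and f: "f \<in> epi (Q\<lparr>carrier := S\<rparr>) N"
  proof (rule hom_image_division[OF \<open>monoid Q\<close> \<open>monoid N\<close> \<xi>(1) \<eta>])
    fix u v
    assume uv: "u \<in> lists G" "v \<in> lists G" and eq: "word_value Q \<xi> u = word_value Q \<xi> v"
    have val: "h (word_value Q \<xi> w) = word_value P \<kappa> w" if "w \<in> lists G" for w
    proof -
      have "h (word_value Q \<xi> w) = word_value P (h \<circ> \<xi>) w"
        using that \<xi>(1) h epi_one[OF \<open>monoid Q\<close> \<open>monoid P\<close> iso_imp_epi[OF h]]
        by (intro Q.word_value_hom) (auto simp: iso_iff)
      also have "\<dots> = word_value P \<kappa> w"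
        using that \<xi>(2) by (intro word_value_cong) auto
      finally show ?thesis .
    qed
    have "word_value P \<kappa> w = (\<lambda>j\<in>{0..<card I}. word_value (M (b j)) (\<theta> (b j)) w)" for w
      using word_value_product[of "{0..<card I}" "M \<circ> b" "\<lambda>j. \<theta> (b j)"]
      unfolding P_def \<kappa>_def comp_def .
    then have "word_value (M (b j)) (\<theta> (b j)) u = word_value (M (b j)) (\<theta> (b j)) v"
      if "j < card I" for j
      using val[OF uv(1)] val[OF uv(2)] eq that by (auto dest!: fun_cong[of _ _ j])
    then have "word_value (M i) (\<theta> i) u = word_value (M i) (\<theta> i) v" if "i \<in> b ` {0..<card I}" for i
      using that by auto
    then show "word_value N \<eta> u = word_value N \<eta> v"
      using ker[OF uv] bij_betw_imp_surj_on[OF b] by blast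
  qed
  have sub: "\<forall>M\<in>K. \<forall>S. submonoid S M \<longrightarrow> M\<lparr>carrier := S\<rparr> \<in> K"
    using K(1) unfolding pseudovariety_def by (elim conjE)
  have epi: "\<forall>M\<in>K. \<forall>N f. monoid N \<and> f \<in> epi M N \<longrightarrow> N \<in> K"
    using K(1) unfolding pseudovariety_def by (elim conjE)
  have "Q\<lparr>carrier := S\<rparr> \<in> K"
    using sub \<open>Q \<in> K\<close> S by blast
  then show ?thesis
    using epi \<open>monoid N\<close> f by blast
qed

section \<open>Quotients of free monoids\<close>

lemma subseq_concat_map:
  assumes "subseq u v"
  shows "subseq (concat (map \<sigma> u)) (concat (map \<sigma> v))"
  using assms by induction (auto intro: list_emb_append_mono)

text \<open>Keep only the letters of \<open>u\<close> whose images are used. Each uses up at least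
  one letter of \<open>w\<close>, whence the length bound, which makes Simon's congruence invariant
  under substitution.\<close>

lemma subseq_concat_mapE:
  assumes "subseq w (concat (map \<sigma> u))"
  obtains u' where "subseq u' u" "length u' \<le> length w" "subseq w (concat (map \<sigma> u'))"
proof -
  have "\<exists>u'. subseq u' u \<and> length u' \<le> length w \<and> subseq w (concat (map \<sigma> u'))"
    using assms
  proof (induction u arbitrary: w)
    case (Cons x u)
    then obtain w1 w2 where w: "w = w1 @ w2" "subseq w1 (\<sigma> x)" "subseq w2 (concat (map \<sigma> u))"
      by (auto simp: subseq_append_iff)
    obtain u' where u': "subseq u' u" "length u' \<le> length w2" "subseq w2 (concat (map \<sigma> u'))"
      using Cons.IH[OF w(3)] by blast
    show ?case
    proof (cases w1)
      case Nil
      then show ?thesis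
        using u' w by (intro exI[of _ u']) auto
    next
      case (Cons c w1')
      then have "subseq w (concat (map \<sigma> (x # u')))"
        using u' w by (auto simp del: append_Cons intro!: list_emb_append_mono)
      then show ?thesis
        using u' w Cons by (intro exI[of _ "x # u'"]) simp
    qed
  next
    case Nil
    then show ?case
      by (intro exI[of _ "[]"]) simp
  qed
  then show thesis
    using that by blast
qed

lemma simon_subst:
  assumes "simon n u v"
  shows "simon n (concat (map \<sigma> u)) (concat (map \<sigma> v))"
proof -
  have "subseq w (concat (map \<sigma> v))"
    if sim: "simon n u v" and len: "length w \<le> n" and sub: "subseq w (concat (map \<sigma> u))" for u v w
  proof -
    obtain u' where u': "subseq u' u" "length u' \<le> length w" "subseq w (concat (map \<sigma> u'))"
      using subseq_concat_mapE[OF sub] .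
    then have "subseq u' v"
      using simonD[OF sim, of u'] len by auto
    then show ?thesis
      using u'(3) subseq_concat_map subseq_order.order_trans by blast
  qed
  then show ?thesis
    using assms simon_sym unfolding simon_def[of n "concat (map \<sigma> u)"] by metis
qed

locale word_congruence =
  fixes A :: "'a set" and R :: "('a list \<times> 'a list) set"
  assumes equiv: "equiv (lists A) R"
    and append: "(u, v) \<in> R \<Longrightarrow> (u', v') \<in> R \<Longrightarrow> (u @ u', v @ v') \<in> R"
begin

abbreviation "Q \<equiv> quotient_monoid A R"

lemma class_eq_iff: "u \<in> lists A \<Longrightarrow> v \<in> lists A \<Longrightarrow> R `` {u} = R `` {v} \<longleftrightarrow> (u, v) \<in> R"
  using eq_equiv_class_iff[OF equiv] .

lemma class_self: "u \<in> lists A \<Longrightarrow> u \<in> R `` {u}"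
  using equiv_class_self[OF equiv] .

lemma class_in_carrier: "u \<in> lists A \<Longrightarrow> R `` {u} \<in> carrier Q"
  by (simp add: quotient_monoid_def quotientI)

lemma carrierE:
  assumes "C \<in> carrier Q"
  obtains u where "u \<in> lists A" "C = R `` {u}"
  using assms unfolding quotient_monoid_def quotient_def by (auto simp del: in_lists_conv_set)

lemma class_mult:
  assumes "u \<in> lists A" "v \<in> lists A"
  shows "R `` {u} \<otimes>\<^bsub>Q\<^esub> R `` {v} = R `` {u @ v}"
proof -
  let ?X = "{x @ y | x y. x \<in> R `` {u} \<and> y \<in> R `` {v}}"
  have "R `` {z} = R `` {u @ v}" if z: "z \<in> ?X" for z
  proof -
    obtain x y where "z = x @ y" "(u, x) \<in> R" "(v, y) \<in> R"
      using z by blast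
    then show ?thesis
      using append equiv_class_eq[OF equiv] by metis
  qed
  moreover have "u @ v \<in> ?X"
    using class_self assms by blast
  ultimately have "R `` ?X = R `` {u @ v}"
    by blast
  then show ?thesis
    by (simp add: quotient_monoid_def)
qed

lemma one_eq: "\<one>\<^bsub>Q\<^esub> = R `` {[]}"
  by (simp add: quotient_monoid_def)

lemma monoid_quotient: "monoid Q"
proof (rule monoidI)
  fix C D E assume "C \<in> carrier Q" "D \<in> carrier Q" "E \<in> carrier Q"
  then show "C \<otimes>\<^bsub>Q\<^esub> D \<otimes>\<^bsub>Q\<^esub> E = C \<otimes>\<^bsub>Q\<^esub> (D \<otimes>\<^bsub>Q\<^esub> E)"
    by (elim carrierE) (simp add: class_mult del: in_lists_conv_set)
next
  show "\<one>\<^bsub>Q\<^esub> \<in> carrier Q"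
    unfolding one_eq by (rule class_in_carrier) simp
next
  fix C D assume "C \<in> carrier Q" "D \<in> carrier Q"
  then obtain u v where "u \<in> lists A" "v \<in> lists A" "C = R `` {u}" "D = R `` {v}"
    by (elim carrierE)
  then show "C \<otimes>\<^bsub>Q\<^esub> D \<in> carrier Q"
    by (simp add: class_mult class_in_carrier del: in_lists_conv_set)
next
  fix C assume "C \<in> carrier Q"
  then obtain u where u: "u \<in> lists A" "C = R `` {u}"
    by (elim carrierE)
  then show "\<one>\<^bsub>Q\<^esub> \<otimes>\<^bsub>Q\<^esub> C = C" "C \<otimes>\<^bsub>Q\<^esub> \<one>\<^bsub>Q\<^esub> = C"
    using class_mult[of "[]" u] class_mult[of u "[]"] by (simp_all add: one_eq)
qed

lemma word_value_class:
  assumes "\<And>x. x \<in> set w \<Longrightarrow> \<sigma> x \<in> lists A"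
  shows "word_value Q (\<lambda>x. R `` {\<sigma> x}) w = R `` {concat (map \<sigma> w)}"
  using assms
proof (induction w)
  case (Cons x w)
  have "concat (map \<sigma> w) \<in> lists A"
    using Cons.prems by (auto simp: in_lists_conv_set)
  then show ?case
    using Cons class_mult[of "\<sigma> x" "concat (map \<sigma> w)"] by simp
qed (simp add: one_eq)

lemma satisfies_quotient_iff:
  "satisfies Q e \<longleftrightarrow>
     (\<forall>\<sigma>. range \<sigma> \<subseteq> lists A \<longrightarrow> (concat (map \<sigma> (fst e)), concat (map \<sigma> (snd e))) \<in> R)"
proof -
  have concat: "concat (map \<sigma> w) \<in> lists A" if "range \<sigma> \<subseteq> lists A" for \<sigma> :: "nat \<Rightarrow> 'a list" and w
    using that by (induction w) auto
  have val: "word_value Q (\<lambda>x. R `` {\<sigma> x}) w = R `` {concat (map \<sigma> w)}"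
    if "range \<sigma> \<subseteq> lists A" for \<sigma> :: "nat \<Rightarrow> 'a list" and w
    by (rule word_value_class) (use that in blast)
  show ?thesis
    unfolding monoid.satisfies_iff_word_value[OF monoid_quotient]
  proof (intro iffI allI impI)
    fix \<sigma> :: "nat \<Rightarrow> 'a list"
    assume sat: "\<forall>\<theta>. range \<theta> \<subseteq> carrier Q \<longrightarrow> word_value Q \<theta> (fst e) = word_value Q \<theta> (snd e)"
      and \<sigma>: "range \<sigma> \<subseteq> lists A"
    have "range (\<lambda>x. R `` {\<sigma> x}) \<subseteq> carrier Q"
      using \<sigma> class_in_carrier by blast
    then have "word_value Q (\<lambda>x. R `` {\<sigma> x}) (fst e) = word_value Q (\<lambda>x. R `` {\<sigma> x}) (snd e)"
      using sat by blast
    then show "(concat (map \<sigma> (fst e)), concat (map \<sigma> (snd e))) \<in> R"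
      unfolding val[OF \<sigma>] by (rule eq_equiv_class[OF _ equiv concat[OF \<sigma>]])
  next
    fix \<theta> :: "nat \<Rightarrow> 'a list set"
    assume R: "\<forall>\<sigma>. range \<sigma> \<subseteq> lists A \<longrightarrow> (concat (map \<sigma> (fst e)), concat (map \<sigma> (snd e))) \<in> R"
      and \<theta>: "range \<theta> \<subseteq> carrier Q"
    have "\<forall>x. \<exists>u. u \<in> lists A \<and> \<theta> x = R `` {u}"
      using \<theta> carrierE by (metis rangeI subsetD)
    then obtain \<sigma> where \<sigma>: "\<And>x. \<sigma> x \<in> lists A" "\<theta> = (\<lambda>x. R `` {\<sigma> x})"
      by metis
    then have "range \<sigma> \<subseteq> lists A"
      by blast
    then show "word_value Q \<theta> (fst e) = word_value Q \<theta> (snd e)"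
      unfolding \<sigma>(2) using R val equiv_class_eq[OF equiv] by metis
  qed
qed

lemma satisfies_quotient:
  assumes "\<And>u v. u \<in> lists A \<Longrightarrow> v \<in> lists A \<Longrightarrow> simon n u v \<Longrightarrow> (u, v) \<in> R"
    and "e \<in> J_identities n"
  shows "satisfies Q e"
  unfolding satisfies_quotient_iff
proof (intro allI impI)
  fix \<sigma> :: "nat \<Rightarrow> 'a list"
  assume "range \<sigma> \<subseteq> lists A"
  then have "concat (map \<sigma> w) \<in> lists A" for w
    by (induction w) auto
  then show "(concat (map \<sigma> (fst e)), concat (map \<sigma> (snd e))) \<in> R"
    using assms simon_subst unfolding J_identities_iff by blast
qed

text \<open>A class is determined by the set of words of length at most \<open>n\<close> over
  \<open>A\<close> that embed in its members, and there are finitely many such sets.\<close>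

lemma finite_quotient:
  assumes "\<And>u v. u \<in> lists A \<Longrightarrow> v \<in> lists A \<Longrightarrow> simon n u v \<Longrightarrow> (u, v) \<in> R"
    and "finite A"
  shows "finite (carrier Q)"
proof -
  define W where "W = {w. set w \<subseteq> A \<and> length w \<le> n}"
  define sub where "sub u = {w \<in> W. subseq w u}" for u
  have simon: "simon n u v" if "sub u = sub v" "u \<in> lists A" "v \<in> lists A" for u v
    unfolding simon_def
  proof (intro allI impI)
    fix w :: "'a list"
    assume "length w \<le> n"
    then have "w \<in> sub u \<longleftrightarrow> subseq w u" "w \<in> sub v \<longleftrightarrow> subseq w v"
      using that(2,3) list_emb_set by (fastforce simp: sub_def W_def)+
    then show "subseq w u \<longleftrightarrow> subseq w v"
      using that(1) by simp
  qed
  have "carrier Q \<subseteq> (\<lambda>X. R `` {SOME u. u \<in> lists A \<and> sub u = X}) ` Pow W"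
  proof
    fix C assume "C \<in> carrier Q"
    then obtain u where u: "u \<in> lists A" "C = R `` {u}"
      by (elim carrierE)
    define v where "v = (SOME v. v \<in> lists A \<and> sub v = sub u)"
    have v: "v \<in> lists A \<and> sub v = sub u"
      unfolding v_def by (rule someI[of _ u]) (use u in simp)
    then have "C = R `` {v}"
      using assms(1) simon u equiv_class_eq[OF equiv] by metis
    then show "C \<in> (\<lambda>X. R `` {SOME u. u \<in> lists A \<and> sub u = X}) ` Pow W"
      unfolding v_def by (rule image_eqI) (auto simp: sub_def)
  qed
  moreover have "finite W"
    unfolding W_def by (rule finite_lists_length_le[OF assms(2)])
  ultimately show ?thesis
    by (meson finite_Pow_iff finite_surj)
qed

end

interpretation styl: word_congruence "{1..n}" "stylic_congruence n"
  rewrites "quotient_monoid {1..n} (stylic_congruence n) = styl n" for n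
  by unfold_locales
    (auto simp: styl_def presented_monoid_def intro: generated_congruence.mult equiv_generated_congruence)

lemma finite_styl: "n \<ge> 1 \<Longrightarrow> finite (carrier (styl n))"
  by (rule styl.finite_quotient[where n = n]) (assumption | rule simon_imp_stylic finite_atLeastAtMost)+

lemma satisfies_styl_iff:
  assumes "n \<ge> 1"
  shows "satisfies (styl n) e \<longleftrightarrow> e \<in> J_identities n"
proof
  assume "e \<in> J_identities n"
  then show "satisfies (styl n) e"
    using assms by (intro styl.satisfies_quotient simon_imp_stylic)
next
  assume sat: "satisfies (styl n) e"
  have "subseq w (fst e) \<longleftrightarrow> subseq w (snd e)" if "length w \<le> n" for w
  proof -
    \<comment> \<open>The codes run up to \<open>length w\<close>, so the bound \<open>n\<close> on
      the length is the bound on the generators.\<close>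
    have "range (staircase_subst w) \<subseteq> lists {1..n}"
      using that by (auto simp: staircase_subst_def simp del: upt_Suc)
    then have "(concat (map (staircase_subst w) (fst e)), concat (map (staircase_subst w) (snd e)))
        \<in> stylic_congruence n"
      using sat unfolding styl.satisfies_quotient_iff by blast
    from stylic_staircase[OF this staircase_rev_upt[of 1 "Suc (length w)"]] show ?thesis
      unfolding staircase_subst_subseq .
  qed
  then show "e \<in> J_identities n"
    by (simp add: J_identities_iff simon_def)
qed

section \<open>The generated variety and pseudovariety\<close>

text \<open>The easy half of Birkhoff's theorem.\<close>

lemma variety_models: "variety (models E :: 'u monoid set)"
  unfolding variety_def
proof (intro conjI allI impI ballI)
  fix N :: "'u monoid"
  assume "N \<in> models E"
  then show "monoid N" by (simp add: models_def)
next
  fix I :: "('u \<Rightarrow> 'u) set" and M :: "('u \<Rightarrow> 'u) \<Rightarrow> 'u monoid" and S and N :: "'u monoid" and f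
  assume asm: "(\<forall>i\<in>I. M i \<in> models E) \<and> submonoid S (product_group I M) \<and> monoid N \<and>
    f \<in> epi ((product_group I M)\<lparr>carrier := S\<rparr>) N"
  let ?P = "product_group I M"
  have mon: "monoid (M i)" "\<forall>e\<in>E. satisfies (M i) e" if "i \<in> I" for i
  proof -
    have "M i \<in> models E"
      using asm that by blast
    then show "monoid (M i)" "\<forall>e\<in>E. satisfies (M i) e"
      by (simp_all add: models_def)
  qed
  have P: "monoid ?P"
    by (intro monoid_product_group mon)
  have S: "monoid (?P\<lparr>carrier := S\<rparr>)"
    using asm P submonoid.submonoid_is_monoid by blast
  have "satisfies N e" if "e \<in> E" for e
  proof (rule satisfies_epi[OF S])
    have "satisfies ?P e"
      unfolding monoid.satisfies_iff_word_value[OF P]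
    proof (intro allI impI)
      fix \<theta> :: "nat \<Rightarrow> ('u \<Rightarrow> 'u) \<Rightarrow> 'u"
      assume \<theta>: "range \<theta> \<subseteq> carrier ?P"
      define \<eta> where "\<eta> i x = \<theta> x i" for i x
      have "\<theta> x = (\<lambda>i\<in>I. \<eta> i x)" for x
        using \<theta> unfolding \<eta>_def by (metis PiE_restrict carrier_product_group rangeI subsetD restrict_ext)
      then have "\<theta> = (\<lambda>x. \<lambda>i\<in>I. \<eta> i x)"
        by (rule ext)
      then have val: "word_value ?P \<theta> w = (\<lambda>i\<in>I. word_value (M i) (\<eta> i) w)" for w
        using word_value_product by metis
      have "word_value (M i) (\<eta> i) (fst e) = word_value (M i) (\<eta> i) (snd e)" if "i \<in> I" for i
      proof -
        have "range (\<eta> i) \<subseteq> carrier (M i)"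
          using \<theta> that by (auto simp: \<eta>_def image_subset_iff)
        then show ?thesis
          using mon[OF that] \<open>e \<in> E\<close> monoid.satisfies_iff_word_value by blast
      qed
      then show "word_value ?P \<theta> (fst e) = word_value ?P \<theta> (snd e)"
        unfolding val by (rule restrict_ext)
    qed
    moreover have "S \<subseteq> carrier ?P"
      using asm submonoid.subset by blast
    then have "id \<in> mon (?P\<lparr>carrier := S\<rparr>) ?P"
      by (simp add: mon_def hom_def subset_iff del: carrier_product_group)
    ultimately show "satisfies (?P\<lparr>carrier := S\<rparr>) e"
      using satisfies_mon[OF S P] by simp
  qed (use asm in auto)
  then show "N \<in> models E"
    using asm by (auto simp: models_def)
qed

text \<open>The elements of \<open>N\<close> themselves serve as variables, and \<open>u\<close>,
  \<open>v\<close> are evaluated under the identity assignment. As identities are written in natural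
  numbers, \<open>c\<close> renames the finitely many letters involved.\<close>

lemma word_value_eqI:
  assumes "monoid M" "monoid N"
    and sat: "\<And>e. satisfies M e \<Longrightarrow> satisfies N e"
    and uv: "u \<in> lists (carrier N)" "v \<in> lists (carrier N)"
    and eq: "\<And>\<theta>. \<theta> \<in> carrier N \<rightarrow>\<^sub>E carrier M \<Longrightarrow> word_value M \<theta> u = word_value M \<theta> v"
  shows "word_value N (\<lambda>x. x) u = word_value N (\<lambda>x. x) v"
proof -
  interpret N: monoid N by fact
  obtain c :: "_ \<Rightarrow> nat" where c: "inj_on c (set (u @ v))"
    using finite_imp_inj_to_nat_seg[of "set (u @ v)"] by auto
  have "satisfies M (map c u, map c v)"
    unfolding monoid.satisfies_iff_word_value[OF \<open>monoid M\<close>]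
  proof (intro allI impI)
    fix \<theta> :: "nat \<Rightarrow> _"
    assume "range \<theta> \<subseteq> carrier M"
    then have "restrict (\<theta> \<circ> c) (carrier N) \<in> carrier N \<rightarrow>\<^sub>E carrier M"
      by auto
    from eq[OF this] have "word_value M (\<theta> \<circ> c) u = word_value M (\<theta> \<circ> c) v"
      using uv word_value_cong[of u "restrict (\<theta> \<circ> c) (carrier N)" "\<theta> \<circ> c" M]
        word_value_cong[of v "restrict (\<theta> \<circ> c) (carrier N)" "\<theta> \<circ> c" M] by auto
    then show "word_value M \<theta> (fst (map c u, map c v)) = word_value M \<theta> (snd (map c u, map c v))"
      by (simp add: word_value_map)
  qed
  from sat[OF this] have satN: "satisfies N (map c u, map c v)" .
  define \<theta> where "\<theta> k = (if k \<in> c ` set (u @ v) then inv_into (set (u @ v)) c k else \<one>\<^bsub>N\<^esub>)" for k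
  have \<theta>c: "(\<theta> \<circ> c) x = x" if "x \<in> set (u @ v)" for x
    using c that by (simp add: \<theta>_def)
  have "\<theta> k \<in> carrier N" for k
    using inv_into_into[of k c "set (u @ v)"] uv by (auto simp: \<theta>_def)
  then have "word_value N (\<theta> \<circ> c) u = word_value N (\<theta> \<circ> c) v"
    using satN unfolding N.satisfies_iff_word_value by (auto simp: word_value_map)
  then show ?thesis
    using word_value_cong[of u "\<theta> \<circ> c" "\<lambda>x. x" N] word_value_cong[of v "\<theta> \<circ> c" "\<lambda>x. x" N] \<theta>c by simp
qed

lemma (in monoid) carrier_word_value: "carrier G \<subseteq> word_value G (\<lambda>x. x) ` lists (carrier G)"
proof
  fix x assume "x \<in> carrier G"
  then show "x \<in> word_value G (\<lambda>x. x) ` lists (carrier G)"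
    by (intro image_eqI[of _ _ "[x]"]) auto
qed

text \<open>The hard half of Birkhoff's theorem: \<open>N\<close> is an image of a submonoid of a
  power of a copy \<open>M'\<close>, with one factor for each assignment of the elements of
  \<open>N\<close> to elements of \<open>M'\<close>. These assignments are functions
  \<open>'u \<Rightarrow> 'u\<close>, the index type in \<open>variety\<close>.\<close>

lemma generated_variety_finite:
  fixes M :: "('a, 'c) monoid_scheme"
  assumes "monoid M" "finite (carrier M)"
  shows "(generated_variety M :: 'u::infinite monoid set) = models {e. satisfies M e}"
proof
  have "copies M \<subseteq> (models {e. satisfies M e} :: 'u monoid set)"
    using satisfies_copies[OF assms(1)] by (auto simp: models_def copies_def)
  then show "(generated_variety M :: 'u monoid set) \<subseteq> models {e. satisfies M e}"
    using variety_models unfolding generated_variety_def by blast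
  show "models {e. satisfies M e} \<subseteq> (generated_variety M :: 'u monoid set)"
    unfolding generated_variety_def
  proof (intro subsetI InterI)
    fix N :: "'u monoid" and K :: "'u monoid set"
    assume N: "N \<in> models {e. satisfies M e}" and "K \<in> {K. variety K \<and> copies M \<subseteq> K}"
    then have K: "variety K" "copies M \<subseteq> K" and "monoid N"
      by (auto simp: models_def)
    interpret N: monoid N by fact
    obtain M' :: "'u monoid" where M': "M' \<in> copies M"
      using finite_copyE[OF assms] by blast
    then have "monoid M'" by (simp add: copies_def)
    have sat: "satisfies N e" if "satisfies M' e" for e
    proof -
      have "satisfies M e"
        using that satisfies_copies[OF assms(1) M'] by blast
      then show ?thesis
        using N unfolding models_def by blast
    qed
    show "N \<in> K"
    proof (rule variety_division[OF K(1) _ \<open>monoid N\<close> _ _ N.carrier_word_value])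
      show "M' \<in> K" using M' K(2) by blast
      show "\<theta> x \<in> carrier M'" if "\<theta> \<in> carrier N \<rightarrow>\<^sub>E carrier M'" "x \<in> carrier N" for \<theta> x
        using that by auto
      show "word_value N (\<lambda>x. x) u = word_value N (\<lambda>x. x) v"
        if "u \<in> lists (carrier N)" "v \<in> lists (carrier N)"
          "\<And>\<theta>. \<theta> \<in> carrier N \<rightarrow>\<^sub>E carrier M' \<Longrightarrow> word_value M' \<theta> u = word_value M' \<theta> v" for u v
        using word_value_eqI[OF \<open>monoid M'\<close> \<open>monoid N\<close> sat that] .
    qed
  qed
qed

text \<open>The same power construction; between finite carriers there are finitely many
  assignments, so the product is finite.\<close>

lemma pseudovariety_member:
  fixes M :: "('a, 'c) monoid_scheme" and K :: "'u::infinite monoid set"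
  assumes "monoid M" "finite (carrier M)" "pseudovariety K" "copies M \<subseteq> K"
    and "monoid N" "finite (carrier N)" and sat: "\<And>e. satisfies M e \<Longrightarrow> satisfies N e"
  shows "N \<in> K"
proof -
  interpret N: monoid N by fact
  obtain M' :: "'u monoid" where M': "M' \<in> copies M"
    using finite_copyE[OF assms(1,2)] by blast
  then have "monoid M'" "finite (carrier M')"
    using assms(2) finite_copies by (auto simp: copies_def)
  have sat': "satisfies N e" if "satisfies M' e" for e
    using that sat satisfies_copies[OF assms(1) M'] by blast
  show ?thesis
  proof (rule pseudovariety_division[OF assms(3) _ _ \<open>monoid N\<close> _ _ N.carrier_word_value])
    show "M' \<in> K" using M' assms(4) by blast
    show "finite (carrier N \<rightarrow>\<^sub>E carrier M')"
      by (intro finite_PiE assms(6) \<open>finite (carrier M')\<close>)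
    show "\<theta> x \<in> carrier M'" if "\<theta> \<in> carrier N \<rightarrow>\<^sub>E carrier M'" "x \<in> carrier N" for \<theta> x
      using that by auto
    show "word_value N (\<lambda>x. x) u = word_value N (\<lambda>x. x) v"
      if "u \<in> lists (carrier N)" "v \<in> lists (carrier N)"
        "\<And>\<theta>. \<theta> \<in> carrier N \<rightarrow>\<^sub>E carrier M' \<Longrightarrow> word_value M' \<theta> u = word_value M' \<theta> v" for u v
      using word_value_eqI[OF \<open>monoid M'\<close> \<open>monoid N\<close> sat' that] .
  qed
qed

lemma generated_variety_styl:
  assumes "n \<ge> 1"
  shows "(generated_variety (styl n) :: 'u::infinite monoid set) = models (J_identities n)"
  using generated_variety_finite[OF styl.monoid_quotient finite_styl[OF assms]]
    satisfies_styl_iff[OF assms] by simp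

section \<open>Piecewise testable languages\<close>

lemma simon_piecewise_testable:
  assumes "L \<in> piecewise_testable n A" "simon n u v" "u \<in> lists A" "v \<in> lists A"
  shows "u \<in> L \<longleftrightarrow> v \<in> L"
  using assms by induction (auto simp: simon_def)

lemma word_congruence_syntactic: "word_congruence A (syntactic_congruence A L)"
proof
  show "equiv (lists A) (syntactic_congruence A L)"
    by (rule equivI) (auto simp: syntactic_congruence_def refl_on_def sym_def trans_def)
  fix u v u' v'
  assume uv: "(u, v) \<in> syntactic_congruence A L" "(u', v') \<in> syntactic_congruence A L"
  have "p @ (u @ u') @ q \<in> L \<longleftrightarrow> p @ (v @ v') @ q \<in> L" if "p \<in> lists A" "q \<in> lists A" for p q
  proof -
    have lists: "u' \<in> lists A" "v \<in> lists A"
      using uv by (auto simp: syntactic_congruence_def)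
    have "p @ u @ (u' @ q) \<in> L \<longleftrightarrow> p @ v @ (u' @ q) \<in> L"
      using uv(1) that lists unfolding syntactic_congruence_def by (auto simp del: in_lists_conv_set)
    moreover have "(p @ v) @ u' @ q \<in> L \<longleftrightarrow> (p @ v) @ v' @ q \<in> L"
      using uv(2) that lists unfolding syntactic_congruence_def by (auto simp del: in_lists_conv_set append_assoc)
    ultimately show ?thesis by simp
  qed
  then show "(u @ u', v @ v') \<in> syntactic_congruence A L"
    using uv by (auto simp: syntactic_congruence_def)
qed

lemma simon_imp_syntactic:
  assumes "L \<in> piecewise_testable n A" "simon n u v" "u \<in> lists A" "v \<in> lists A"
  shows "(u, v) \<in> syntactic_congruence A L"
  using assms simon_context[OF assms(2)] simon_piecewise_testable[OF assms(1)]
  by (auto simp: syntactic_congruence_def simp del: in_lists_conv_set)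

lemma syntactic_in_pseudovariety:
  fixes K :: "'u::infinite monoid set"
  assumes "n \<ge> 1" and K: "pseudovariety K" "copies (styl n) \<subseteq> K"
    and AL: "finite A" "L \<in> piecewise_testable n A" and N: "N \<in> copies (syntactic_monoid A L)"
  shows "N \<in> K"
proof -
  interpret L: word_congruence A "syntactic_congruence A L"
    by (rule word_congruence_syntactic)
  note simon = simon_imp_syntactic[OF AL(2)]
  have fin: "finite (carrier (syntactic_monoid A L))"
    unfolding syntactic_monoid_def by (rule L.finite_quotient[where n = n]) (assumption | rule simon AL(1))+
  have mon: "monoid (syntactic_monoid A L)"
    unfolding syntactic_monoid_def by (rule L.monoid_quotient)
  show "N \<in> K"
  proof (rule pseudovariety_member[OF styl.monoid_quotient finite_styl[OF assms(1)] K])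
    show "monoid N" "finite (carrier N)"
      using N fin finite_copies[OF N] by (auto simp: copies_def)
    fix e assume "satisfies (styl n) e"
    then have "e \<in> J_identities n"
      using satisfies_styl_iff[OF assms(1)] by blast
    then have "satisfies (syntactic_monoid A L) e"
      unfolding syntactic_monoid_def by (rule L.satisfies_quotient[where n = n, rotated]) (assumption | rule simon)+
    then show "satisfies N e"
      using satisfies_copies[OF mon N] by blast
  qed
qed

text \<open>Brings a copy of the quotient into the shape that the division lemmas expect: generated
  by the letters, with kernel \<open>R\<close>.\<close>

lemma (in word_congruence) quotient_copyE:
  assumes "N \<in> copies Q"
  obtains \<eta> where "\<And>a. a \<in> A \<Longrightarrow> \<eta> a \<in> carrier N" "carrier N \<subseteq> word_value N \<eta> ` lists A"
    "\<And>u v. u \<in> lists A \<Longrightarrow> v \<in> lists A \<Longrightarrow> word_value N \<eta> u = word_value N \<eta> v \<longleftrightarrow> (u, v) \<in> R"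
proof -
  obtain h where "monoid N" and h: "h \<in> iso N Q"
    using assms by (auto simp: copies_def is_iso_def)
  interpret N: monoid N by fact
  have inj: "inj_on h (carrier N)" and surj: "h ` carrier N = carrier Q" and hom: "h \<in> hom N Q"
    using h by (auto simp: iso_iff)
  define \<eta> where "\<eta> a = inv_into (carrier N) h (R `` {[a]})" for a
  have \<eta>: "\<eta> a \<in> carrier N" "h (\<eta> a) = R `` {[a]}" if "a \<in> A" for a
  proof -
    have "R `` {[a]} \<in> h ` carrier N"
      unfolding surj using class_in_carrier[of "[a]"] that by simp
    then show "\<eta> a \<in> carrier N" "h (\<eta> a) = R `` {[a]}"
      unfolding \<eta>_def by (rule inv_into_into, rule f_inv_into_f)
  qed
  have closed: "word_value N \<eta> u \<in> carrier N" if "u \<in> lists A" for u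
    by (rule N.word_value_closed, rule \<eta>(1)) (use that in auto)
  have val: "h (word_value N \<eta> u) = R `` {u}" if "u \<in> lists A" for u
  proof -
    have A: "a \<in> A" if "a \<in> set u" for a
      using that \<open>u \<in> lists A\<close> by auto
    have "h (word_value N \<eta> u) = word_value Q (h \<circ> \<eta>) u"
      by (rule N.word_value_hom[OF \<eta>(1)[OF A] hom epi_one[OF \<open>monoid N\<close> monoid_quotient iso_imp_epi[OF h]]])
    also have "\<dots> = word_value Q (\<lambda>a. R `` {[a]}) u"
      by (rule word_value_cong) (use A \<eta>(2) in simp)
    also have "\<dots> = R `` {concat (map (\<lambda>a. [a]) u)}"
      by (rule word_value_class) (use A in simp)
    finally show ?thesis by simp
  qed
  show thesis
  proof (rule that)
    show "\<eta> a \<in> carrier N" if "a \<in> A" for a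
      by (rule \<eta>(1)[OF that])
    show "carrier N \<subseteq> word_value N \<eta> ` lists A"
    proof
      fix x assume x: "x \<in> carrier N"
      then have "h x \<in> carrier Q"
        unfolding surj[symmetric] by (rule imageI)
      then obtain u where u: "u \<in> lists A" "h x = R `` {u}"
        by (rule carrierE)
      then have "x = word_value N \<eta> u"
        using inj_onD[OF inj _ x closed] val by metis
      then show "x \<in> word_value N \<eta> ` lists A"
        using u(1) by (rule image_eqI)
    qed
    fix u v assume uv: "u \<in> lists A" "v \<in> lists A"
    have "word_value N \<eta> u = word_value N \<eta> v \<longleftrightarrow> R `` {u} = R `` {v}"
      using val[OF uv(1)] val[OF uv(2)] inj_on_eq_iff[OF inj closed[OF uv(1)] closed[OF uv(2)]] by simp
    then show "word_value N \<eta> u = word_value N \<eta> v \<longleftrightarrow> (u, v) \<in> R"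
      using class_eq_iff[OF uv] by simp
  qed
qed

text \<open>\<open>N\<close> divides the product of the syntactic monoids of the languages
  \<open>L w\<close>, one for each \<open>w\<close> of length at most \<open>n\<close> over the
  generators. Words identified in all factors contain the same such \<open>w\<close>, hence are
  equal in the stylic monoid.\<close>

lemma styl_in_pseudovariety:
  fixes K :: "'u::infinite monoid set"
  assumes "n \<ge> 1" and K: "pseudovariety K"
    and KL: "\<And>(A :: nat set) L. finite A \<Longrightarrow> L \<in> piecewise_testable n A \<Longrightarrow> copies (syntactic_monoid A L) \<subseteq> K"
    and N: "N \<in> copies (styl n)"
  shows "N \<in> K"
proof -
  let ?A = "{1..n}"
  define L where "L w = {u \<in> lists ?A. subseq w u}" for w
  define W where "W = {w. set w \<subseteq> ?A \<and> length w \<le> n}"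
  have L: "L w \<in> piecewise_testable n ?A" if "w \<in> W" for w
    unfolding L_def by (rule piecewise_testable.basic) (use that in \<open>auto simp: W_def\<close>)
  have "\<exists>M \<theta>. M \<in> K \<and> (\<forall>a\<in>?A. \<theta> a \<in> carrier M) \<and>
      (\<forall>u\<in>lists ?A. \<forall>v\<in>lists ?A. word_value M \<theta> u = word_value M \<theta> v \<longleftrightarrow>
        (u, v) \<in> syntactic_congruence ?A (L w))" if "w \<in> W" for w
  proof -
    interpret S: word_congruence ?A "syntactic_congruence ?A (L w)"
      by (rule word_congruence_syntactic)
    have "finite (carrier S.Q)"
      by (rule S.finite_quotient[where n = n])
        (assumption | rule simon_imp_syntactic[OF L[OF that]] finite_atLeastAtMost)+
    then obtain M :: "'u monoid" where M: "M \<in> copies S.Q"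
      using finite_copyE[OF S.monoid_quotient] by blast
    obtain \<theta> where "\<And>a. a \<in> ?A \<Longrightarrow> \<theta> a \<in> carrier M"
      "\<And>u v. u \<in> lists ?A \<Longrightarrow> v \<in> lists ?A \<Longrightarrow>
        word_value M \<theta> u = word_value M \<theta> v \<longleftrightarrow> (u, v) \<in> syntactic_congruence ?A (L w)"
      using S.quotient_copyE[OF M] by metis
    moreover have "M \<in> K"
      using KL[OF finite_atLeastAtMost L[OF that]] M unfolding syntactic_monoid_def by blast
    ultimately show ?thesis by blast
  qed
  then obtain M :: "nat list \<Rightarrow> 'u monoid" and \<theta> where M: "\<And>w. w \<in> W \<Longrightarrow> M w \<in> K"
    and \<theta>: "\<And>w a. w \<in> W \<Longrightarrow> a \<in> ?A \<Longrightarrow> \<theta> w a \<in> carrier (M w)"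
    and ker: "\<And>w u v. w \<in> W \<Longrightarrow> u \<in> lists ?A \<Longrightarrow> v \<in> lists ?A \<Longrightarrow>
      word_value (M w) (\<theta> w) u = word_value (M w) (\<theta> w) v \<longleftrightarrow> (u, v) \<in> syntactic_congruence ?A (L w)"
    by metis
  obtain \<eta> where \<eta>: "\<And>a. a \<in> ?A \<Longrightarrow> \<eta> a \<in> carrier N" "carrier N \<subseteq> word_value N \<eta> ` lists ?A"
    "\<And>u v. u \<in> lists ?A \<Longrightarrow> v \<in> lists ?A \<Longrightarrow>
      word_value N \<eta> u = word_value N \<eta> v \<longleftrightarrow> (u, v) \<in> stylic_congruence n"
    using styl.quotient_copyE[OF N] by metis
  have "finite W"
    unfolding W_def by (rule finite_lists_length_le) simp
  show "N \<in> K"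
  proof (rule pseudovariety_division[OF K M \<open>finite W\<close> _ \<theta> \<eta>(1,2)])
    show "monoid N"
      using N by (simp add: copies_def)
    fix u v
    assume uv: "u \<in> lists ?A" "v \<in> lists ?A"
      and eq: "\<And>w. w \<in> W \<Longrightarrow> word_value (M w) (\<theta> w) u = word_value (M w) (\<theta> w) v"
    have "simon n u v"
      unfolding simon_def
    proof (intro allI impI)
      fix w :: "nat list"
      assume len: "length w \<le> n"
      show "subseq w u \<longleftrightarrow> subseq w v"
      proof (cases "set w \<subseteq> ?A")
        case True
        then have "w \<in> W"
          using len by (simp add: W_def)
        then have "(u, v) \<in> syntactic_congruence ?A (L w)"
          using eq ker[OF _ uv] by blast
        then have "[] @ u @ [] \<in> L w \<longleftrightarrow> [] @ v @ [] \<in> L w"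
          unfolding syntactic_congruence_def by blast
        then show ?thesis
          using uv by (simp add: L_def)
      next
        case False
        have "set w \<subseteq> ?A" if "subseq w u" "u \<in> lists ?A" for u
          using that list_emb_set[OF that(1)] by fastforce
        then show ?thesis
          using uv False by blast
      qed
    qed
    then show "word_value N \<eta> u = word_value N \<eta> v"
      using \<eta>(3)[OF uv] simon_imp_stylic[OF _ assms(1) uv] by blast
  qed
qed

text \<open>Both sides are intersections, and a pseudovariety contains one generating class exactly
  if it contains the other.\<close>

lemma generated_pseudovariety_styl:
  assumes "n \<ge> 1"
  shows "(generated_pseudovariety (copies (styl n)) :: 'u::infinite monoid set) = J_pseudovariety n"
proof -
  let ?X = "(\<Union>A \<in> {A :: nat set. finite A}. \<Union>L \<in> piecewise_testable n A.
    copies (syntactic_monoid A L)) :: 'u monoid set"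
  have "copies (styl n) \<subseteq> K \<longleftrightarrow> ?X \<subseteq> K" if "pseudovariety K" for K
  proof
    assume "copies (styl n) \<subseteq> K"
    then show "?X \<subseteq> K"
      using syntactic_in_pseudovariety[OF assms that] by (intro UN_least) blast
  next
    assume X: "?X \<subseteq> K"
    have "copies (syntactic_monoid A L) \<subseteq> K" if "finite A" "L \<in> piecewise_testable n A" for A :: "nat set" and L
      by (rule subset_trans[OF _ X]) (use that in blast)
    then show "copies (styl n) \<subseteq> K"
      using styl_in_pseudovariety[OF assms that] by blast
  qed
  then have "{K. pseudovariety K \<and> copies (styl n) \<subseteq> K} = {K. pseudovariety K \<and> ?X \<subseteq> K}"
    by blast
  then show ?thesis
    unfolding J_pseudovariety_def eilenberg_pseudovariety_def generated_pseudovariety_def by simp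
qed

lemma subseq_replicate_iff: "subseq w (replicate m x) \<longleftrightarrow> length w \<le> m \<and> set w \<subseteq> {x}"
proof (induction m arbitrary: w)
  case (Suc m)
  then show ?case
    by (cases w) auto
next
  case 0
  then show ?case
    by (cases w) auto
qed

lemma generated_variety_styl_strict:
  assumes "n \<ge> 1"
  shows "(generated_variety (styl n) :: 'u::infinite monoid set) \<subset> generated_variety (styl (n + 1))"
proof -
  have mono: "J_identities (n + 1) \<subseteq> J_identities n"
    using simon_mono by (fastforce simp: J_identities_iff)
  \<comment> \<open>The identity \<open>x^n \<approx> x^(n+1)\<close> separates the two
    ranks.\<close>
  let ?e = "(replicate n 0, replicate (n + 1) 0)"
  have e: "?e \<in> J_identities n" "?e \<notin> J_identities (n + 1)"
  proof -
    have "subseq (replicate (n + 1) 0) (replicate (n + 1) 0)" "\<not> subseq (replicate (n + 1) 0) (replicate n 0)"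
      by auto
    then show "?e \<notin> J_identities (n + 1)"
      unfolding J_identities_iff simon_def fst_conv snd_conv by (metis length_replicate order.refl)
    show "?e \<in> J_identities n"
      by (simp add: J_identities_iff simon_def subseq_replicate_iff del: replicate_Suc)
  qed
  obtain N :: "'u monoid" where N: "N \<in> copies (styl (n + 1))"
    using finite_copyE[OF styl.monoid_quotient finite_styl[of "n + 1"]] by auto
  have "satisfies N e \<longleftrightarrow> e \<in> J_identities (n + 1)" for e
    using satisfies_copies[OF styl.monoid_quotient N] satisfies_styl_iff[of "n + 1"] by simp
  then have "N \<in> models (J_identities (n + 1))" "N \<notin> models (J_identities n)"
    using N e by (auto simp: models_def copies_def)
  moreover have "models (J_identities n) \<subseteq> (models (J_identities (n + 1)) :: 'u monoid set)"
    using mono by (auto simp: models_def)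
  ultimately show ?thesis
    using generated_variety_styl[OF assms] generated_variety_styl[of "n + 1"] by auto
qed

section \<open>Bases for ranks one to three\<close>

text \<open>The split with all depth on the left. After a word that absorbs \<open>x\<close> and
  \<open>y\<close> at depth \<open>m\<close>, the block \<open>xy\<close> can be inflated by
  \<open>insert\<close> to its power \<open>m + 1\<close>, turned round by \<open>comm\<close> and
  deflated again; hence such letters commute. The final \<open>a\<close> thereby travels back to the
  last \<open>a\<close> of \<open>p\<close>, next to which \<open>insert\<close> deletes it.\<close>

lemma absorb_snoc:
  fixes \<psi> :: "'a list \<Rightarrow> 'b"
  assumes cong: "\<And>p u v q. \<psi> u = \<psi> v \<Longrightarrow> \<psi> (p @ u @ q) = \<psi> (p @ v @ q)"
    and insert: "\<And>p a q. simon m p (p @ [a]) \<Longrightarrow> a \<in> set q \<Longrightarrow> \<psi> (p @ a # q) = \<psi> (p @ q)"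
    and comm: "\<And>p x y q. \<psi> (p @ concat (replicate (Suc m) [x, y]) @ q) =
      \<psi> (p @ concat (replicate (Suc m) [y, x]) @ q)"
    and "simon (Suc m) p (p @ [a])"
  shows "\<psi> (p @ [a]) = \<psi> p"
proof -
  have pump: "\<psi> (s @ concat (replicate j [x, y]) @ [x, y]) = \<psi> (s @ [x, y])"
    if "simon m s (s @ [x])" "simon m s (s @ [y])" for s x y j
  proof (induction j)
    case (Suc j)
    let ?w = "concat (replicate j [x, y]) @ [x, y]"
    have "\<psi> (s @ x # y # ?w) = \<psi> (s @ y # ?w)" "\<psi> (s @ y # ?w) = \<psi> (s @ ?w)"
      by (rule insert; use that in simp)+
    with Suc show ?case by simp
  qed simp
  have exchange: "\<psi> (s @ [x, y]) = \<psi> (s @ [y, x])"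
    if "simon m s (s @ [x])" "simon m s (s @ [y])" for s x y
  proof -
    have pow: "concat (replicate (Suc m) [x, y]) = concat (replicate m [x, y]) @ [x, y]" for x y :: 'a
      by (induction m) auto
    have "\<psi> (s @ [x, y]) = \<psi> (s @ concat (replicate (Suc m) [x, y]) @ [])"
      unfolding pow using pump[OF that] by simp
    also have "\<dots> = \<psi> (s @ concat (replicate (Suc m) [y, x]) @ [])"
      by (rule comm)
    also have "\<dots> = \<psi> (s @ [y, x])"
      unfolding pow using pump[OF that(2,1)] by simp
    finally show ?thesis .
  qed
  obtain s t where st: "p = s @ a # t" and absorb: "\<And>c. c \<in> set (a # t) \<Longrightarrow> simon m s (s @ [c])"
    using simon_snocE[OF assms(4)] by metis
  have move: "\<psi> (s @ r @ [a]) = \<psi> (s @ a # r)" if "set r \<subseteq> set (a # t)" for r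
    using that
  proof (induction r rule: rev_induct)
    case (snoc c r)
    have sr: "simon m s (s @ r)"
      by (rule simon_absorb_letters, rule absorb) (use snoc.prems in auto)
    have "simon m (s @ r) (s @ r @ [c])" "simon m (s @ r) (s @ r @ [a])"
      by (rule simon_snoc_append[OF absorb sr]; use snoc.prems in simp)+
    then have "\<psi> ((s @ r) @ [c, a]) = \<psi> ((s @ r) @ [a, c])"
      by (intro exchange) simp_all
    moreover have "\<psi> (s @ r @ [a]) = \<psi> (s @ a # r)"
      using snoc by simp
    from cong[OF this, of "[]" "[c]"] have "\<psi> ((s @ r) @ [a, c]) = \<psi> (s @ a # r @ [c])"
      by simp
    ultimately show ?case by simp
  qed simp
  have "\<psi> (s @ (a # t) @ [a]) = \<psi> (s @ a # a # t)"
    by (rule move) simp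
  also have "\<dots> = \<psi> (s @ a # t)"
    by (rule insert) (use absorb in auto)
  finally show ?thesis
    using st by simp
qed

lemma absorb_Cons:
  fixes \<psi> :: "'a list \<Rightarrow> 'b"
  assumes cong: "\<And>p u v q. \<psi> u = \<psi> v \<Longrightarrow> \<psi> (p @ u @ q) = \<psi> (p @ v @ q)"
    and insert: "\<And>p a q. simon m q (a # q) \<Longrightarrow> a \<in> set p \<Longrightarrow> \<psi> (p @ a # q) = \<psi> (p @ q)"
    and comm: "\<And>p x y q. \<psi> (p @ concat (replicate (Suc m) [x, y]) @ q) =
      \<psi> (p @ concat (replicate (Suc m) [y, x]) @ q)"
    and "simon (Suc m) q (a # q)"
  shows "\<psi> (a # q) = \<psi> q"
proof -
  define \<phi> where "\<phi> w = \<psi> (rev w)" for w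
  have rev_pow: "rev (concat (replicate k [x, y])) = concat (replicate k [y, x])" for k and x y :: 'a
    by (simp add: rev_concat)
  have "\<phi> (rev q @ [a]) = \<phi> (rev q)"
  proof (rule absorb_snoc[of \<phi> m])
    show "\<phi> (p @ u @ q) = \<phi> (p @ v @ q)" if "\<phi> u = \<phi> v" for p u v q
      using cong[OF that[unfolded \<phi>_def], of "rev q" "rev p"] by (simp add: \<phi>_def)
    show "\<phi> (p @ a # q) = \<phi> (p @ q)" if "simon m p (p @ [a])" "a \<in> set q" for p a q
      using insert[of "rev p" a "rev q"] that simon_rev[of m p "p @ [a]"] by (simp add: \<phi>_def)
    show "\<phi> (p @ concat (replicate (Suc m) [x, y]) @ q) = \<phi> (p @ concat (replicate (Suc m) [y, x]) @ q)"
      for p x y q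
      using comm[of "rev q" y x "rev p"] by (simp add: \<phi>_def rev_pow del: replicate_Suc)
    show "simon (Suc m) (rev q) (rev q @ [a])"
      using assms(4) simon_rev[of "Suc m" q "a # q"] by simp
  qed
  then show ?thesis
    by (simp add: \<phi>_def)
qed

lemma simon_Suc_0: "simon (Suc 0) p (p @ [a]) \<longleftrightarrow> a \<in> set p" "simon (Suc 0) q (a # q) \<longleftrightarrow> a \<in> set q"
proof -
  have *: "length w \<le> Suc 0 \<longleftrightarrow> w = [] \<or> (\<exists>b. w = [b])" for w :: "'a list"
    by (cases w) auto
  show "simon (Suc 0) p (p @ [a]) \<longleftrightarrow> a \<in> set p" "simon (Suc 0) q (a # q) \<longleftrightarrow> a \<in> set q"
    unfolding simon_def * by (auto simp: subseq_singleton_left split: if_splits)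
qed

text \<open>Depth two on the left means \<open>p = s @ a # t\<close> where all letters of
  \<open>a # t\<close> occur in \<open>s\<close>. The identity \<open>id3\<close> then lets
  \<open>a\<close> cross one letter of \<open>t\<close>, given that \<open>a\<close> recurs in
  \<open>q\<close>; the doubled \<open>a\<close> it asks for is supplied and removed by
  \<open>id1\<close>.\<close>

lemma insert_two_one:
  fixes \<psi> :: "'a list \<Rightarrow> 'b"
  assumes id1: "\<And>p x y z q. \<psi> (p @ x # y @ x # x # z @ x # q) = \<psi> (p @ x # y @ x # z @ x # q)"
    and id3: "\<And>p x y z t q. \<psi> (p @ z # y @ x # x # z # t @ x # q) = \<psi> (p @ z # y @ x # x # z # x # t @ x # q)"
    and "simon (Suc (Suc 0)) p (p @ [a])" "a \<in> set q"
  shows "\<psi> (p @ a # q) = \<psi> (p @ q)"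
proof -
  have dup: "\<psi> (s @ a # a # q) = \<psi> (s @ a # q)" if sq: "a \<in> set s" "a \<in> set q" for s q
  proof -
    obtain s1 s2 where "s = s1 @ a # s2"
      using sq(1) by (meson split_list)
    moreover obtain q1 q2 where "q = q1 @ a # q2"
      using sq(2) by (meson split_list)
    ultimately show ?thesis
      using id1[of s1 a s2 q1 q2] by simp
  qed
  have step: "\<psi> (s @ a # b # a # q) = \<psi> (s @ a # b # q)"
    if mem: "a \<in> set s" "b \<in> set s" "a \<in> set q" for s b q
  proof -
    obtain s1 s2 where s: "s = s1 @ b # s2"
      using mem(2) by (meson split_list)
    obtain q1 q2 where q: "q = q1 @ a # q2"
      using mem(3) by (meson split_list)
    have "\<psi> (s @ a # b # q) = \<psi> (s @ a # a # b # q)"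
      using dup[of s "b # q"] mem by simp
    also have "\<dots> = \<psi> (s @ a # a # b # a # q)"
      using id3[of s1 b s2 a q1 q2] s q by simp
    also have "\<dots> = \<psi> (s @ a # b # a # q)"
      using dup[of s "b # a # q"] mem by simp
    finally show ?thesis ..
  qed
  \<comment> \<open>Each hop over a letter \<open>b\<close> leaves a copy of \<open>a\<close> behind
    it, from which the rest of \<open>t\<close> is crossed; afterwards the copy is removed
    again.\<close>
  have spread: "\<psi> (s @ a # t @ a # q) = \<psi> (s @ a # t @ q)" if "a \<in> set s" "set t \<subseteq> set s" for s t
    using that
  proof (induction t arbitrary: s)
    case Nil
    then show ?case
      using dup assms(4) by simp
  next
    case (Cons b t)
    have "\<psi> (s @ a # (b # t) @ q) = \<psi> (s @ a # b # a # t @ q)"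
      using step[of s b "t @ q"] Cons.prems assms(4) by simp
    also have "\<dots> = \<psi> (s @ a # b # a # t @ a # q)"
      using Cons.IH[of "s @ [a, b]"] Cons.prems by (simp add: subset_insertI2)
    also have "\<dots> = \<psi> (s @ a # b # t @ a # q)"
      using step[of s b "t @ a # q"] Cons.prems by simp
    finally show ?case by simp
  qed
  obtain s t where "p = s @ a # t" and "\<And>c. c \<in> set (a # t) \<Longrightarrow> simon (Suc 0) s (s @ [c])"
    using simon_snocE[OF assms(3)] by metis
  then show ?thesis
    using spread[of s t] by (auto simp: simon_Suc_0)
qed

text \<open>Completeness of \<open>B\<close> reduces to single insertions: the premises on
  \<open>\<psi>\<close> are what the evaluation of words in a model of \<open>B\<close> provides,
  namely compatibility with contexts and all substitution instances of \<open>B\<close>.\<close>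

lemma is_basisI:
  assumes "n \<ge> 1" and B: "B \<subseteq> J_identities n"
    and insert: "\<And>(\<psi> :: nat list \<Rightarrow> 'u::infinite) p a q.
      (\<And>p u v q. \<psi> u = \<psi> v \<Longrightarrow> \<psi> (p @ u @ q) = \<psi> (p @ v @ q)) \<Longrightarrow>
      (\<And>e \<sigma> p q. e \<in> B \<Longrightarrow>
        \<psi> (p @ concat (map \<sigma> (fst e)) @ q) = \<psi> (p @ concat (map \<sigma> (snd e)) @ q)) \<Longrightarrow>
      simon n (p @ q) (p @ a # q) \<Longrightarrow> \<psi> (p @ a # q) = \<psi> (p @ q)"
  shows "is_basis TYPE('u) B (styl n)"
  unfolding is_basis_def
proof (intro conjI ballI allI impI)
  show "satisfies (styl n) e" if "e \<in> B" for e
    using that B satisfies_styl_iff[OF assms(1)] by blast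
  fix e and N :: "'u monoid"
  assume "satisfies (styl n) e" and N: "N \<in> models B"
  then have e: "simon n (fst e) (snd e)"
    using satisfies_styl_iff[OF assms(1)] J_identities_iff by blast
  have sat: "satisfies N e" if "e \<in> B" for e
    using N that by (simp add: models_def)
  interpret N: monoid N
    using N by (simp add: models_def)
  show "satisfies N e"
    unfolding N.satisfies_iff_word_value
  proof (intro allI impI)
    fix \<theta> :: "nat \<Rightarrow> 'u"
    assume \<theta>: "range \<theta> \<subseteq> carrier N"
    define \<psi> where "\<psi> = word_value N \<theta>"
    have closed: "\<psi> w \<in> carrier N" for w
      unfolding \<psi>_def by (rule N.word_value_closed) (use \<theta> in blast)
    have app: "\<psi> (u @ v) = \<psi> u \<otimes>\<^bsub>N\<^esub> \<psi> v" for u v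
      unfolding \<psi>_def by (rule N.word_value_append) (use \<theta> in blast)
    have cong: "\<psi> (p @ u @ q) = \<psi> (p @ v @ q)" if "\<psi> u = \<psi> v" for p u v q
      using that by (simp add: app)
    have inst: "\<psi> (p @ concat (map \<sigma> (fst e)) @ q) = \<psi> (p @ concat (map \<sigma> (snd e)) @ q)"
      if "e \<in> B" for e \<sigma> p q
    proof (rule cong)
      have "\<psi> (concat (map \<sigma> w)) = word_value N (\<lambda>x. \<psi> (\<sigma> x)) w" for w
        by (induction w) (simp_all add: app, simp add: \<psi>_def)
      moreover have "range (\<lambda>x. \<psi> (\<sigma> x)) \<subseteq> carrier N"
        using closed by blast
      ultimately show "\<psi> (concat (map \<sigma> (fst e))) = \<psi> (concat (map \<sigma> (snd e)))"
        using sat[OF that] unfolding N.satisfies_iff_word_value by metis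
    qed
    have "\<psi> (fst e) = \<psi> (snd e)"
      by (rule simon_imp_eq[where A = UNIV, OF _ e assms(1)]) (auto intro: insert[OF cong inst])
    then show "word_value N \<theta> (fst e) = word_value N \<theta> (snd e)"
      by (simp add: \<psi>_def)
  qed
qed

text \<open>Converse of \<open>simon_insertE\<close>: in a new subsequence \<open>x @ a # y\<close>
  the part \<open>x\<close> has length at least \<open>k\<close> and \<open>y\<close> at least
  \<open>l\<close>, so the whole is longer than \<open>k + l\<close>.\<close>

lemma simon_insertI:
  assumes "simon k p (p @ [a])" "simon l q (a # q)"
  shows "simon (k + l) (p @ q) (p @ a # q)"
proof (rule ccontr)
  assume "\<not> ?thesis"
  then obtain w where w: "length w \<le> k + l" "subseq w (p @ a # q)" "\<not> subseq w (p @ q)"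
    using not_simon_insert[of "k + l" p q "[a]"] by auto
  then obtain x y where xy: "w = x @ a # y" "subseq x p" "subseq y q"
    "\<not> subseq (x @ [a]) p" "\<not> subseq (a # y) q"
    using subseq_insert_letterE[OF w(2,3)] by metis
  have "k < length (x @ [a])"
    using simonD[OF assms(1), of "x @ [a]"] xy(2,4) by (auto simp: subseq_append)
  moreover have "l < length (a # y)"
    using simonD[OF assms(2), of "a # y"] xy(3,5) by auto
  ultimately show False
    using w(1) xy(1) by simp
qed

lemma simon_commute: "simon n u v \<longleftrightarrow> simon n v u"
  using simon_sym by blast

text \<open>Converse of \<open>simon_snocE\<close>. A new subsequence ends in the appended
  \<open>a\<close>; the part \<open>x\<close> before it has length at most \<open>k\<close> and does
  not embed in \<open>s\<close>, although \<open>s\<close> absorbs everything that follows it at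
  depth \<open>k\<close>.\<close>

lemma simon_snocI:
  assumes "\<And>c. c \<in> set (a # t) \<Longrightarrow> simon k s (s @ [c])"
  shows "simon (Suc k) (s @ a # t) (s @ a # t @ [a])"
proof (rule ccontr)
  assume "\<not> ?thesis"
  then obtain w where w: "length w \<le> Suc k" "subseq w ((s @ a # t) @ a # [])" "\<not> subseq w ((s @ a # t) @ [])"
    using not_simon_insert[of "Suc k" "s @ a # t" "[]" "[a]"] by auto
  then obtain x y where xy: "w = x @ a # y" "subseq x (s @ a # t)" "subseq y []"
    "\<not> subseq (x @ [a]) (s @ a # t)"
    using subseq_insert_letterE[OF w(2,3)] by metis
  obtain x1 x2 where x: "x = x1 @ x2" "subseq x1 s" "subseq x2 (a # t)" "\<not> subseq x s"
  proof -
    have "subseq (x @ [a]) (s @ a # t)" if "subseq x s"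
      using that by (intro list_emb_append_mono) auto
    then show thesis
      using that xy(2,4) by (auto simp: subseq_append_iff)
  qed
  have "simon k s (s @ x2)"
    by (rule simon_absorb_letters, rule assms) (use list_emb_set[OF x(3)] in auto)
  moreover have "subseq x (s @ x2)"
    unfolding x(1) using x(2) by (intro list_emb_append_mono) auto
  moreover have "length x \<le> k"
    using w(1) xy(1) by simp
  ultimately show False
    using x(4) simonD by blast
qed

lemma simon_ConsI:
  assumes "\<And>c. c \<in> set (t @ [a]) \<Longrightarrow> simon l s (c # s)"
  shows "simon (Suc l) (t @ a # s) (a # t @ a # s)"
proof -
  have "simon (Suc l) (rev s @ a # rev t) (rev s @ a # rev t @ [a])"
  proof (rule simon_snocI)
    show "simon l (rev s) (rev s @ [c])" if "c \<in> set (a # rev t)" for c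
      using assms[of c] that simon_rev[of l s "c # s"] by auto
  qed
  then show ?thesis
    using simon_rev[of "Suc l" "t @ a # s" "a # t @ a # s"] by simp
qed

lemma subseq_concat_replicate:
  assumes "length w \<le> m" "set w \<subseteq> set u"
  shows "subseq w (concat (replicate m u))"
  using assms
proof (induction m arbitrary: w)
  case (Suc m)
  then show ?case
    using list_emb_append_mono[of "(=)" "[hd w]" u "tl w" "concat (replicate m u)"]
    by (cases w) (auto simp: subseq_singleton_left)
qed simp

text \<open>Each of the \<open>n\<close> copies of \<open>u\<close> supplies one letter, so the
  short subsequences of the power are all short words over the letters of \<open>u\<close>.\<close>

lemma simon_power:
  assumes "set u = set v"
  shows "simon n (concat (replicate n u)) (concat (replicate n v))"
proof -
  have "subseq w (concat (replicate n u)) \<longleftrightarrow> set w \<subseteq> set u" if "length w \<le> n" for w and u :: "'a list"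
  proof
    assume "subseq w (concat (replicate n u))"
    then have "set w \<subseteq> set (concat (replicate n u))"
      using list_emb_set[of "(=)" w "concat (replicate n u)"] by blast
    also have "\<dots> \<subseteq> set u"
      by auto
    finally show "set w \<subseteq> set u" .
  qed (rule subseq_concat_replicate[OF that])
  then show ?thesis
    using assms by (auto simp: simon_def)
qed

section \<open>The three bases\<close>

lemma is_basis_styl_1: "is_basis TYPE('u::infinite) {([x, x], [x]), ([x, y], [y, x])} (styl 1)"
  if "x \<noteq> y"
proof (rule is_basisI)
  show "{([x, x], [x]), ([x, y], [y, x])} \<subseteq> J_identities 1"
    using simon_snocI[of x "[]" 0 "[]"] simon_power[of "[x, y]" "[y, x]" 1]
    by (auto simp: J_identities_iff insert_commute intro: simon_sym)
next
  fix \<psi> :: "nat list \<Rightarrow> 'u" and p q :: "nat list" and a :: nat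
  assume cong: "\<And>p u v q. \<psi> u = \<psi> v \<Longrightarrow> \<psi> (p @ u @ q) = \<psi> (p @ v @ q)"
    and inst: "\<And>e \<sigma> p q. e \<in> {([x, x], [x]), ([x, y], [y, x])} \<Longrightarrow>
        \<psi> (p @ concat (map \<sigma> (fst e)) @ q) = \<psi> (p @ concat (map \<sigma> (snd e)) @ q)"
    and sim: "simon 1 (p @ q) (p @ a # q)"
  have idem: "\<psi> (p @ u @ u @ q) = \<psi> (p @ u @ q)" for p q u
    using inst[of "([x, x], [x])" p "\<lambda>_. u" q] by simp
  have comm: "\<psi> (p @ u @ v @ q) = \<psi> (p @ v @ u @ q)" for p q u v
    using inst[of "([x, y], [y, x])" p "(\<lambda>_. u)(y := v)" q] that by simp
  have insert: "\<psi> (p @ a # q) = \<psi> (p @ q)" if mem: "a \<in> set (p @ q)" for p q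
  proof -
    consider s t where "p = s @ a # t" | s t where "q = s @ a # t"
      using mem by (auto dest: split_list)
    then show ?thesis
    proof cases
      case (1 s t)
      then show ?thesis
        using comm[of "s @ [a]" t "[a]" q] idem[of s "[a]" "t @ q"] by simp
    next
      case (2 s t)
      then show ?thesis
        using comm[of p "[a]" s "a # t"] idem[of "p @ s" "[a]" t] by simp
    qed
  qed
  show "\<psi> (p @ a # q) = \<psi> (p @ q)"
    by (rule insert) (use simon_set[OF sim] in auto)
qed simp

text \<open>The first identity is the insertion of split \<open>1 + 1\<close>. The splits
  \<open>2 + 0\<close> and \<open>0 + 2\<close> are reduced to it by the second identity.\<close>

lemma is_basis_styl_2:
  "is_basis TYPE('u::infinite) {([x, y, x, z, x], [x, y, z, x]), ([x, y, x, y], [y, x, y, x])} (styl 2)"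
  if dist: "distinct [x, y, z]"
proof (rule is_basisI)
  have "simon (1 + 1) ([x, y] @ [z, x]) ([x, y] @ x # [z, x])"
    by (rule simon_insertI) (simp_all add: simon_Suc_0 simon_Suc_0(1)[of "[x, y]", simplified])
  then have "simon 2 [x, y, x, z, x] [x, y, z, x]"
    by (subst simon_commute) (simp add: numeral_2_eq_2)
  moreover have "simon 2 [x, y, x, y] [y, x, y, x]"
    using simon_power[of "[x, y]" "[y, x]" 2] by (simp add: insert_commute numeral_2_eq_2)
  ultimately show "{([x, y, x, z, x], [x, y, z, x]), ([x, y, x, y], [y, x, y, x])} \<subseteq> J_identities 2"
    by (simp add: J_identities_iff)
next
  fix \<psi> :: "nat list \<Rightarrow> 'u" and p q :: "nat list" and a :: nat
  assume cong: "\<And>p u v q. \<psi> u = \<psi> v \<Longrightarrow> \<psi> (p @ u @ q) = \<psi> (p @ v @ q)"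
    and inst: "\<And>e \<sigma> p q. e \<in> {([x, y, x, z, x], [x, y, z, x]), ([x, y, x, y], [y, x, y, x])} \<Longrightarrow>
        \<psi> (p @ concat (map \<sigma> (fst e)) @ q) = \<psi> (p @ concat (map \<sigma> (snd e)) @ q)"
    and sim: "simon 2 (p @ q) (p @ a # q)"
  have id1: "\<psi> (p @ b # u @ b # v @ b # q) = \<psi> (p @ b # u @ v @ b # q)" for p q b u v
    using inst[of "([x, y, x, z, x], [x, y, z, x])" p "(\<lambda>_. [b])(y := u, z := v)" q] dist by simp
  have comm: "\<psi> (p @ concat (replicate (Suc 1) [b, c]) @ q) = \<psi> (p @ concat (replicate (Suc 1) [c, b]) @ q)"
    for p q b c
    using inst[of "([x, y, x, y], [y, x, y, x])" p "(\<lambda>_. [b])(y := [c])" q] dist by simp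
  have insert: "\<psi> (p @ a # q) = \<psi> (p @ q)" if "a \<in> set p" "a \<in> set q" for p a q
    using that id1 by (auto dest!: split_list)
  obtain k l where kl: "k + l = 2" "simon k p (p @ [a])" "simon l q (a # q)"
    using simon_insertE[OF sim] .
  have "k = Suc 1 \<or> l = Suc 1 \<or> k = 1 \<and> l = 1"
    using kl(1) by linarith
  then show "\<psi> (p @ a # q) = \<psi> (p @ q)"
  proof (elim disjE conjE)
    assume "k = Suc 1"
    then have "\<psi> (p @ [a]) = \<psi> p"
      using kl(2) by (intro absorb_snoc[OF cong insert comm]) (auto simp: simon_Suc_0)
    then show ?thesis
      using cong[of "p @ [a]" p "[]" q] by simp
  next
    assume "l = Suc 1"
    then have "\<psi> (a # q) = \<psi> q"
      using kl(3) by (intro absorb_Cons[OF cong insert comm]) (auto simp: simon_Suc_0)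
    then show ?thesis
      using cong[of "a # q" q p "[]"] by simp
  next
    assume "k = 1" "l = 1"
    then show ?thesis
      using kl insert by (simp add: simon_Suc_0)
  qed
qed simp

text \<open>The first and third identities give the split \<open>2 + 1\<close>. For
  \<open>1 + 2\<close> the proof is mirrored: the first identity is its own reversal, up to
  renaming, and the second is the reversal of the third. The last identity reduces
  \<open>3 + 0\<close> and \<open>0 + 3\<close> to these.\<close>

lemma is_basis_styl_3:
  "is_basis TYPE('u::infinite)
     {([x, y, x, x, z, x], [x, y, x, z, x]),
      ([x, y, z, x, x, t, z], [x, y, x, z, x, x, t, z]),
      ([z, y, x, x, z, t, x], [z, y, x, x, z, x, t, x]),
      ([x, y, x, y, x, y], [y, x, y, x, y, x])} (styl 3)" (is "is_basis _ ?B _")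
  if dist: "distinct [x, y, z, t]"
proof (rule is_basisI)
  have "simon 2 [x, y, x] [x, y, x, x]"
    using simon_snocI[of x "[]" 1 "[x, y]"] by (simp add: simon_Suc_0 simon_Suc_0(1)[of "[x, y]", simplified] numeral_2_eq_2)
  then have "simon 3 [x, y, x, x, z, x] [x, y, x, z, x]"
    using simon_insertI[of 2 "[x, y, x]" x 1 "[z, x]"] by (subst simon_commute) (simp add: simon_Suc_0)
  moreover have "simon (Suc 1) ([z] @ x # [x, t, z]) (x # [z] @ x # [x, t, z])"
    by (rule simon_ConsI) (auto simp: simon_Suc_0)
  then have "simon 2 [z, x, x, t, z] [x, z, x, x, t, z]"
    by (simp add: numeral_2_eq_2)
  then have "simon 3 [x, y, z, x, x, t, z] [x, y, x, z, x, x, t, z]"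
    using simon_insertI[of 1 "[x, y]" x 2 "[z, x, x, t, z]"]
    by (simp add: simon_Suc_0 simon_Suc_0(1)[of "[x, y]", simplified] numeral_3_eq_3)
  moreover have "simon (Suc 1) ([z, y, x] @ x # [z]) ([z, y, x] @ x # [z] @ [x])"
    by (rule simon_snocI) (auto simp: simon_Suc_0 simp del: append.simps)
  then have "simon 2 [z, y, x, x, z] [z, y, x, x, z, x]"
    by (simp add: numeral_2_eq_2)
  then have "simon 3 [z, y, x, x, z, t, x] [z, y, x, x, z, x, t, x]"
    using simon_insertI[of 2 "[z, y, x, x, z]" x 1 "[t, x]"] by (simp add: simon_Suc_0)
  moreover have "simon 3 [x, y, x, y, x, y] [y, x, y, x, y, x]"
    using simon_power[of "[x, y]" "[y, x]" 3] by (simp add: insert_commute numeral_3_eq_3)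
  ultimately show "?B \<subseteq> J_identities 3"
    by (simp add: J_identities_iff)
next
  fix \<psi> :: "nat list \<Rightarrow> 'u" and p q :: "nat list" and a :: nat
  assume cong: "\<And>p u v q. \<psi> u = \<psi> v \<Longrightarrow> \<psi> (p @ u @ q) = \<psi> (p @ v @ q)"
    and inst: "\<And>e \<sigma> p q. e \<in> ?B \<Longrightarrow>
        \<psi> (p @ concat (map \<sigma> (fst e)) @ q) = \<psi> (p @ concat (map \<sigma> (snd e)) @ q)"
    and sim: "simon 3 (p @ q) (p @ a # q)"
  have id1: "\<psi> (p @ b # u @ b # b # v @ b # q) = \<psi> (p @ b # u @ b # v @ b # q)" for p q b u v
    using inst[of "([x, y, x, x, z, x], [x, y, x, z, x])" p "(\<lambda>_. [b])(y := u, z := v)" q] dist by simp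
  have id2: "\<psi> (p @ b # u @ c # b # b # v @ c # q) = \<psi> (p @ b # u @ b # c # b # b # v @ c # q)" for p q b c u v
    using inst[of "([x, y, z, x, x, t, z], [x, y, x, z, x, x, t, z])" p "(\<lambda>_. [b])(y := u, z := [c], t := v)" q] dist
    by simp
  have id3: "\<psi> (p @ c # u @ b # b # c # v @ b # q) = \<psi> (p @ c # u @ b # b # c # b # v @ b # q)" for p q b c u v
    using inst[of "([z, y, x, x, z, t, x], [z, y, x, x, z, x, t, x])" p "(\<lambda>_. [b])(y := u, z := [c], t := v)" q] dist
    by simp
  have comm: "\<psi> (p @ concat (replicate (Suc 2) [b, c]) @ q) = \<psi> (p @ concat (replicate (Suc 2) [c, b]) @ q)"
    for p q b c
    using inst[of "([x, y, x, y, x, y], [y, x, y, x, y, x])" p "(\<lambda>_. [b])(y := [c])" q] dist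
    by (simp add: numeral_2_eq_2)
  have insert21: "\<psi> (p @ a # q) = \<psi> (p @ q)" if "simon 2 p (p @ [a])" "a \<in> set q" for p a q
    using that by (intro insert_two_one[of \<psi>, OF id1 id3]) (simp_all add: numeral_2_eq_2)
  have insert12: "\<psi> (p @ a # q) = \<psi> (p @ q)" if "simon 2 q (a # q)" "a \<in> set p" for p a q
  proof -
    define \<phi> where "\<phi> w = \<psi> (rev w)" for w
    have "\<phi> (rev q @ a # rev p) = \<phi> (rev q @ rev p)"
    proof (rule insert_two_one)
      show "\<phi> (p @ b # u @ b # b # v @ b # q) = \<phi> (p @ b # u @ b # v @ b # q)" for p q b u v
        using id1[of "rev q" b "rev v" "rev u" "rev p"] by (simp add: \<phi>_def)
      show "\<phi> (p @ c # u @ b # b # c # v @ b # q) = \<phi> (p @ c # u @ b # b # c # b # v @ b # q)" for p q b c u v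
        using id2[of "rev q" b "rev v" c "rev u" "rev p"] by (simp add: \<phi>_def)
      show "simon (Suc (Suc 0)) (rev q) (rev q @ [a])"
        using that(1) simon_rev[of 2 q "a # q"] by (simp add: numeral_2_eq_2)
    qed (use that in simp)
    then show ?thesis
      by (simp add: \<phi>_def)
  qed
  obtain k l where kl: "k + l = 3" "simon k p (p @ [a])" "simon l q (a # q)"
    using simon_insertE[OF sim] .
  have "k = Suc 2 \<or> l = Suc 2 \<or> k = 2 \<and> l = 1 \<or> k = 1 \<and> l = 2"
    using kl(1) by linarith
  then show "\<psi> (p @ a # q) = \<psi> (p @ q)"
  proof (elim disjE conjE)
    assume "k = Suc 2"
    then have "\<psi> (p @ [a]) = \<psi> p"
      using kl(2) by (intro absorb_snoc[OF cong insert21 comm]) auto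
    then show ?thesis
      using cong[of "p @ [a]" p "[]" q] by simp
  next
    assume "l = Suc 2"
    then have "\<psi> (a # q) = \<psi> q"
      using kl(3) by (intro absorb_Cons[OF cong insert12 comm]) auto
    then show ?thesis
      using cong[of "a # q" q p "[]"] by simp
  next
    assume "k = 2" "l = 1"
    then show ?thesis
      using kl insert21 by (simp add: simon_Suc_0)
  next
    assume "k = 1" "l = 2"
    then show ?thesis
      using kl insert12 by (simp add: simon_Suc_0)
  qed
qed simp

section \<open>Ranks above three\<close>

text \<open>The Rees quotient of the free monoid by the ideal of all words that are not factors of
  \<open>u\<close>, with \<open>None\<close> as zero.\<close>

definition factor_monoid :: "'a list \<Rightarrow> 'a list option monoid" where
  "factor_monoid u =
     \<lparr>carrier = insert None (Some ` {w. sublist w u}),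
      monoid.mult = (\<lambda>x y. case (x, y) of
        (Some v, Some w) \<Rightarrow> if sublist (v @ w) u then Some (v @ w) else None | _ \<Rightarrow> None),
      one = Some []\<rparr>"

lemma mult_factor_monoid:
  "x \<otimes>\<^bsub>factor_monoid u\<^esub> y = (case (x, y) of
    (Some v, Some w) \<Rightarrow> if sublist (v @ w) u then Some (v @ w) else None | _ \<Rightarrow> None)"
  by (simp add: factor_monoid_def)

lemma sublist_appendD:
  assumes "sublist (v @ w) u"
  shows "sublist v u" "sublist w u"
proof -
  obtain s t where u: "u = s @ (v @ w) @ t"
    using assms by (auto simp: sublist_def)
  show "sublist v u"
    unfolding sublist_def u by (intro exI[of _ s] exI[of _ "w @ t"]) simp
  show "sublist w u"
    unfolding sublist_def u by (intro exI[of _ "s @ v"] exI[of _ t]) simp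
qed

lemma monoid_factor_monoid: "monoid (factor_monoid u)"
proof (rule monoidI)
  fix x y z
  show "x \<otimes>\<^bsub>factor_monoid u\<^esub> y \<otimes>\<^bsub>factor_monoid u\<^esub> z = x \<otimes>\<^bsub>factor_monoid u\<^esub> (y \<otimes>\<^bsub>factor_monoid u\<^esub> z)"
  proof (cases "x = None \<or> y = None \<or> z = None")
    case False
    then obtain a b c where "x = Some a" "y = Some b" "z = Some c"
      by auto
    then show ?thesis
      using sublist_appendD(1)[of "a @ b" c u] sublist_appendD(2)[of a "b @ c" u]
      by (auto simp: mult_factor_monoid)
  qed (auto simp: mult_factor_monoid split: option.splits)
qed (auto simp: factor_monoid_def split: option.splits)

lemma finite_factor_monoid: "finite (carrier (factor_monoid u))"
proof -
  have "{w. sublist w u} = set (sublists u)"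
    by (simp add: set_sublists_eq)
  then show ?thesis
    by (simp add: factor_monoid_def)
qed

lemma word_value_factor_monoid:
  "word_value (factor_monoid u) \<theta> w =
     (if (\<forall>x\<in>set w. \<theta> x \<noteq> None) \<and> sublist (concat (map (the \<circ> \<theta>) w)) u
      then Some (concat (map (the \<circ> \<theta>) w)) else None)"
proof (induction w)
  case (Cons x w)
  then show ?case
    using sublist_appendD(2)[of "the (\<theta> x)" "concat (map (the \<circ> \<theta>) w)" u]
    by (cases "\<theta> x") (auto simp: mult_factor_monoid comp_def)
qed (simp add: factor_monoid_def)

section \<open>Words that identities in few variables cannot change\<close>

lemma concat_map_eq_append_ConsE:
  assumes "concat (map \<sigma> w) = A @ c # B"
  obtains e g f g1 g2 where "w = e @ g # f" "\<sigma> g = g1 @ c # g2"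
    "A = concat (map \<sigma> e) @ g1" "B = g2 @ concat (map \<sigma> f)"
proof -
  have "\<exists>e g f g1 g2. w = e @ g # f \<and> \<sigma> g = g1 @ c # g2 \<and>
      A = concat (map \<sigma> e) @ g1 \<and> B = g2 @ concat (map \<sigma> f)"
    using assms
  proof (induction w arbitrary: A)
    case (Cons x w)
    then have "\<sigma> x @ concat (map \<sigma> w) = A @ c # B"
      by simp
    then consider us where "\<sigma> x = A @ c # us" "B = us @ concat (map \<sigma> w)"
      | us where "A = \<sigma> x @ us" "concat (map \<sigma> w) = us @ c # B"
      by (auto simp: append_eq_append_conv2 append_eq_Cons_conv Cons_eq_append_conv)
    then show ?case
    proof cases
      case (1 us)
      then show ?thesis
        by (intro exI[of _ "[]"] exI[of _ x] exI[of _ w] exI[of _ A] exI[of _ us]) simp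
    next
      case (2 us)
      obtain e g f g1 g2 where "w = e @ g # f" "\<sigma> g = g1 @ c # g2"
        "us = concat (map \<sigma> e) @ g1" "B = g2 @ concat (map \<sigma> f)"
        using Cons.IH[OF 2(2)] by blast
      then show ?thesis
        using 2(1)
        by (intro exI[of _ "x # e"] exI[of _ g] exI[of _ f] exI[of _ g1] exI[of _ g2]) simp
    qed
  qed simp
  then show thesis
    using that by blast
qed

lemma subseq_replicate_count: "subseq (replicate k x) w \<longleftrightarrow> k \<le> count_list w x"
proof (induction w arbitrary: k)
  case Nil
  then show ?case by (cases k) auto
next
  case (Cons y w)
  show ?case
  proof (cases k)
    case (Suc k')
    then show ?thesis
      using Cons.IH[of k'] Cons.IH[of "Suc k'"] by auto
  qed simp
qed

lemma count_list_concat_map_ge: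
  "count_list w h * count_list (\<sigma> h) c \<le> count_list (concat (map \<sigma> w)) c"
  by (induction w) auto

lemma count_list_concat_map_ge_add:
  assumes "g \<in> set w" "g \<noteq> h"
  shows "count_list w h * count_list (\<sigma> h) c + count_list (\<sigma> g) c \<le> count_list (concat (map \<sigma> w)) c"
proof -
  obtain e f where w: "w = e @ g # f"
    using assms(1) by (meson split_list)
  show ?thesis
    using count_list_concat_map_ge[of e h \<sigma> c] count_list_concat_map_ge[of f h \<sigma> c] assms(2)
    by (simp add: w add_mult_distrib)
qed

lemma count_list_concat_map_eq:
  assumes "\<And>g. g \<in> set w \<Longrightarrow> g \<noteq> h \<Longrightarrow> c \<notin> set (\<sigma> g)" "\<sigma> h = [c]"
  shows "count_list (concat (map \<sigma> w)) c = count_list w h"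
  using assms(1) by (induction w) (auto simp: assms(2) count_list_0_iff)

text \<open>The word \<open>a z\<^sub>r \<dots> z\<^sub>1 a z\<^sub>1 \<dots> z\<^sub>r (y a)\<^sup>m\<close> with \<open>a = 0\<close>, \<open>y = 1\<close> and \<open>z\<^sub>i = i + 1\<close>. An identity
  with fewer than \<open>r\<close> variables cannot insert the letter \<open>a\<close> after \<open>z\<^sub>r\<close>: all letters between that place
  and the preceding \<open>a\<close> would have to be images of variables that occurred earlier, and the
  reversal of \<open>z\<^sub>1 \<dots> z\<^sub>r\<close> forces these images to be single letters.\<close>

definition rigid_prefix :: "nat \<Rightarrow> nat list" where
  "rigid_prefix r = (0 # rev [2..<r + 2]) @ 0 # [2..<r + 2]"

definition rigid_suffix :: "nat \<Rightarrow> nat list" where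
  "rigid_suffix m = concat (replicate m [1, 0])"

text \<open>The split is \<open>2 + m\<close>: all letters from the second \<open>a\<close> on occur
  before it, and \<open>(ya)^m\<close> already contains every word of length at most
  \<open>m\<close> in \<open>a\<close> and \<open>y\<close>.\<close>

lemma simon_rigid:
  "simon (m + 2) (rigid_prefix r @ rigid_suffix m) (rigid_prefix r @ 0 # rigid_suffix m)"
proof -
  have "simon (Suc 1) (rigid_prefix r) (rigid_prefix r @ [0])"
    unfolding rigid_prefix_def append.assoc append.simps(2)[of 0 "[2..<r + 2]"]
    by (rule simon_snocI) (auto simp: simon_Suc_0 simp del: append_Cons)
  moreover have "simon m (rigid_suffix m) (0 # rigid_suffix m)"
    unfolding simon_def
  proof (intro allI impI iffI)
    fix w :: "nat list"
    assume len: "length w \<le> m" and w: "subseq w (0 # rigid_suffix m)"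
    have "set w \<subseteq> set (0 # rigid_suffix m)"
      using list_emb_set[OF w] by blast
    also have "\<dots> \<subseteq> set [1, 0]"
      by (auto simp: rigid_suffix_def)
    finally show "subseq w (rigid_suffix m)"
      unfolding rigid_suffix_def by (rule subseq_concat_replicate[OF len])
  qed auto
  ultimately have "simon (Suc 1 + m) (rigid_prefix r @ rigid_suffix m) (rigid_prefix r @ 0 # rigid_suffix m)"
    by (rule simon_insertI)
  then show ?thesis by simp
qed

lemma count_rigid_suffix: "count_list (rigid_suffix m) c = (if c \<le> 1 then m else 0)"
  by (induction m) (auto simp: rigid_suffix_def)

lemma count_rigid_prefix:
  "count_list (rigid_prefix r) 0 = 2" "count_list (rigid_prefix r) 1 = 0" "count_list (rigid_prefix r) c \<le> 2"
proof -
  have "count_list (rev xs) c = count_list xs c" for xs and c :: nat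
    by (induction xs) auto
  moreover have "count_list [2..<r + 2] c \<le> 1"
    by (induction r) auto
  moreover have "count_list [2..<r + 2] c = 0" if "c < 2" for c
    using that by (auto simp: count_list_0_iff)
  ultimately show "count_list (rigid_prefix r) 0 = 2" "count_list (rigid_prefix r) 1 = 0"
    "count_list (rigid_prefix r) c \<le> 2"
    by (auto simp: rigid_prefix_def)
qed

lemma last_rigid_suffix: "m > 0 \<Longrightarrow> rigid_suffix m \<noteq> [] \<and> last (rigid_suffix m) = 0"
  by (induction m) (auto simp: rigid_suffix_def)

lemma sorted_wrt_subseq_pair: "sorted_wrt P xs \<Longrightarrow> subseq [c, d] xs \<Longrightarrow> P c d"
  by (induction xs) (auto simp: subseq_singleton_left split: if_splits)

text \<open>If \<open>\<sigma> h\<close> is not empty, counting forces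
  \<open>\<sigma> h = [0]\<close> and makes the image of \<open>p @ q\<close> the whole word, so
  that \<open>h\<close> inserts the letter \<open>0\<close> at one place of it. Every place except
  the end of \<open>rigid_prefix r\<close> is excluded by a short subsequence, and that one by the
  number of variables.\<close>

lemma rigid_insert:
  assumes sim: "simon (m + 2) (p @ q) (p @ h # q)" and "m \<ge> 2" and card: "card (set (p @ q)) < r"
    and eq: "\<alpha> @ concat (map \<sigma> (p @ q)) @ \<beta> = rigid_prefix r @ rigid_suffix m"
  shows "\<sigma> h = []"
proof (rule ccontr)
  assume "\<sigma> h \<noteq> []"
  let ?U = "rigid_prefix r @ rigid_suffix m"
  \<comment> \<open>The power of \<open>h\<close> that exceeds its number of occurrences by one is
    created by the insertion, hence must be longer than \<open>m + 2\<close>.\<close>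
  have many: "m + 2 \<le> count_list (p @ q) h"
  proof (rule ccontr)
    assume few: "\<not> ?thesis"
    let ?k = "Suc (count_list (p @ q) h)"
    have "subseq (replicate ?k h) (p @ h # q)" "\<not> subseq (replicate ?k h) (p @ q)"
      unfolding subseq_replicate_count by simp_all
    then show False
      using simonD[OF sim, of "replicate ?k h"] few by simp
  qed
  have U_count: "count_list ?U 0 = m + 2"
    by (simp add: count_rigid_prefix count_rigid_suffix)
  have U_count': "count_list ?U c < m + 2" if "c \<noteq> 0" for c
  proof (cases "c = 1")
    case True
    then show ?thesis
      using count_rigid_prefix(2)[of r] by (simp add: count_rigid_suffix)
  next
    case False
    then show ?thesis
      using count_rigid_prefix(3)[of r c] that \<open>m \<ge> 2\<close> by (simp add: count_rigid_suffix)
  qed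
  have total: "count_list ?U c = count_list \<alpha> c + count_list (concat (map \<sigma> (p @ q))) c + count_list \<beta> c" for c
    unfolding eq[symmetric] by simp
  have le: "(m + 2) * count_list (\<sigma> h) c \<le> count_list (concat (map \<sigma> (p @ q))) c" for c
    by (rule order_trans[OF mult_le_mono1[OF many] count_list_concat_map_ge])
  have "set (\<sigma> h) \<subseteq> {0}"
  proof
    fix c assume "c \<in> set (\<sigma> h)"
    then have "1 \<le> count_list (\<sigma> h) c"
      using count_list_0_iff[of "\<sigma> h" c] by linarith
    then have "m + 2 \<le> (m + 2) * count_list (\<sigma> h) c"
      using mult_le_mono2[of 1 "count_list (\<sigma> h) c" "m + 2"] by (simp only: mult_1_right)
    also have "\<dots> \<le> count_list ?U c"
      unfolding total using le[of c] by linarith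
    finally have "m + 2 \<le> count_list ?U c" .
    then show "c \<in> {0}"
      using U_count'[of c] by fastforce
  qed
  then obtain k where k: "\<sigma> h = replicate k 0"
    by (metis replicate_eqI singletonD subsetD)
  have "k \<ge> 1"
    using \<open>\<sigma> h \<noteq> []\<close> k by (cases k) auto
  have k_count: "count_list (\<sigma> h) 0 = k"
    unfolding k by (induction k) auto
  have at_most: "count_list (concat (map \<sigma> (p @ q))) 0 \<le> m + 2"
    unfolding U_count[symmetric] total by simp
  have "(m + 2) * k \<le> (m + 2) * 1"
    using order_trans[OF le[of 0, unfolded k_count] at_most] by simp
  then have "k \<le> 1"
    unfolding mult_le_cancel1 by simp
  with \<open>k \<ge> 1\<close> have "k = 1"
    by simp
  then have \<sigma>h: "\<sigma> h = [0]"
    using k by simp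
  \<comment> \<open>The \<open>m + 2\<close> letters \<open>0\<close> of the word are used up by the
    occurrences of \<open>h\<close>. Since the word begins and ends with \<open>0\<close>, nothing
    is left for \<open>\<alpha>\<close> and \<open>\<beta>\<close>.\<close>
  have tight: "count_list \<alpha> 0 = 0" "count_list \<beta> 0 = 0" "count_list (p @ q) h = m + 2"
    using le[of 0] total[of 0] U_count many count_list_concat_map_ge[of "p @ q" h \<sigma> 0] by (simp_all add: \<sigma>h)
  have other: "0 \<notin> set (\<sigma> g)" if "g \<in> set (p @ q)" "g \<noteq> h" for g
    using count_list_concat_map_ge_add[OF that, of \<sigma> 0] total[of 0] U_count tight \<sigma>h
    by (simp add: count_list_0_iff)
  have count: "count_list (concat (map \<sigma> w)) 0 = count_list w h" if "set w \<subseteq> set (p @ q)" for w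
    using that other \<sigma>h by (intro count_list_concat_map_eq) auto
  have "\<alpha> = []"
    using eq tight(1) by (cases \<alpha>) (auto simp: rigid_prefix_def)
  have "\<beta> = []"
  proof (cases \<beta> rule: rev_cases)
    case (snoc \<beta>' b)
    have "last ?U = 0"
      using \<open>m \<ge> 2\<close> last_rigid_suffix[of m] by (auto simp: last_append)
    then have "b = 0"
      unfolding eq[symmetric] snoc by simp
    then show ?thesis
      using tight(2) snoc by simp
  qed
  define P Q where "P = concat (map \<sigma> p)" and "Q = concat (map \<sigma> q)"
  have PQ: "P @ Q = ?U"
    using eq \<open>\<alpha> = []\<close> \<open>\<beta> = []\<close> by (simp add: P_def Q_def)
  \<comment> \<open>A short word created by the insertion must occur in \<open>p @ q\<close>
    already, so its image has to be found in the rigid word. All three cases below contradict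
    this.\<close>
  have image: "subseq (concat (map \<sigma> w)) ?U" if "subseq w (p @ h # q)" "length w \<le> m + 2" for w
  proof -
    have "subseq w (p @ q)"
      using that simonD[OF sim] by blast
    from subseq_concat_map[OF this, of \<sigma>] show ?thesis
      using PQ by (simp add: P_def Q_def)
  qed
  have image_replicate: "concat (map \<sigma> (replicate k h)) = replicate k 0" for k
    by (induction k) (auto simp: \<sigma>h)
  have pos: "0 < r"
    using card by simp
  \<comment> \<open>This letter is \<open>z\<^sub>r\<close>, the last one of
    \<open>rigid_prefix r\<close>.\<close>
  let ?z = "r + 1"
  have z_suffix: "?z \<notin> set (rigid_suffix m)"
    using pos by (auto simp: rigid_suffix_def)
  have last_prefix: "\<exists>us. rigid_prefix r = us @ [?z]"
    using pos by (intro exI[of _ "(0 # rev [2..<r + 2]) @ 0 # [2..<r + 1]"]) (simp add: rigid_prefix_def)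
  have card_right: "\<sigma> g = g1 @ c # g2 \<Longrightarrow> c \<noteq> 0 \<Longrightarrow> g \<in> set (p @ q) \<Longrightarrow> g \<noteq> h \<and> count_list g1 0 = 0 \<and> count_list g2 0 = 0"
    for g g1 c g2
    using other[of g] \<sigma>h by (cases "g = h") (auto simp: count_list_0_iff Cons_eq_append_conv)
  obtain us where us: "P @ us = rigid_prefix r \<and> Q = us @ rigid_suffix m \<or>
      P = rigid_prefix r @ us \<and> us @ Q = rigid_suffix m"
    using PQ unfolding append_eq_append_conv2 by metis
  consider us where "us \<noteq> []" "P @ us = rigid_prefix r" "Q = us @ rigid_suffix m"
    | us where "us \<noteq> []" "P = rigid_prefix r @ us" "us @ Q = rigid_suffix m"
    | "P = rigid_prefix r" "Q = rigid_suffix m"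
    using us by (cases "us = []") auto
  then show False
  proof cases
    \<comment> \<open>The place lies before the final \<open>z\<^sub>r\<close>. The variable
      \<open>g\<close> covering that letter follows two \<open>h\<close>, three with the inserted
      one. The word \<open>hhhg\<close> has length four, which is admissible because
      \<open>m \<ge> 2\<close>, but only two letters \<open>0\<close> occur in
      \<open>rigid_prefix r\<close>.\<close>
    case (1 us)
    obtain us' where us': "us = us' @ [?z]"
      using 1(1,2) last_prefix by (metis append_butlast_last_id last_appendR last_snoc)
    have "concat (map \<sigma> q) = us' @ ?z # rigid_suffix m"
      using 1(3) us' by (simp add: Q_def)
    then obtain e g f g1 g2 where g: "q = e @ g # f" "\<sigma> g = g1 @ ?z # g2" "us' = concat (map \<sigma> e) @ g1"
      by (rule concat_map_eq_append_ConsE)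
    have g0: "g \<noteq> h" "count_list g1 0 = 0"
      using card_right[OF g(2)] g(1) by auto
    have pe: "count_list (concat (map \<sigma> p)) 0 = count_list p h" "count_list (concat (map \<sigma> e)) 0 = count_list e h"
      by (rule count; auto simp: g(1))+
    have "count_list (P @ us) 0 = 2"
      unfolding 1(2) by (rule count_rigid_prefix)
    then have "count_list p h + count_list e h = 2"
      using pe g us' g0 by (simp add: P_def)
    then have "subseq (replicate 3 h) (p @ h # e)"
      unfolding subseq_replicate_count by simp
    then have "subseq (replicate 3 h @ [g]) ((p @ h # e) @ g # f)"
      by (rule list_emb_append_mono) simp
    then have "subseq (concat (map \<sigma> (replicate 3 h @ [g]))) ?U"
      using g(1) \<open>m \<ge> 2\<close> by (intro image) simp_all
    then have "subseq ((replicate 3 0 @ g1) @ ?z # g2) ?U"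
      using image_replicate[of 3] g(2) by simp
    then have "subseq ((replicate 3 0 @ g1) @ [?z]) (rigid_prefix r) \<or> subseq (?z # g2) (rigid_suffix m)"
      by (rule subseq_split_Cons)
    moreover have "\<not> subseq (?z # g2) (rigid_suffix m)"
      using z_suffix list_emb_set[of "(=)" "?z # g2" "rigid_suffix m" ?z] by auto
    ultimately have "subseq (replicate 3 0) (rigid_prefix r)"
      using subseq_order.order_trans[of "replicate 3 0" "(replicate 3 0 @ g1) @ [?z]"] by auto
    then show False
      unfolding subseq_replicate_count count_rigid_prefix by simp
  next
    \<comment> \<open>The place lies after the first letter \<open>1\<close>. The variable
      \<open>g\<close> covering it is followed by \<open>m\<close> occurrences of \<open>h\<close>,
      by \<open>m + 1\<close> with the inserted one, whereas \<open>rigid_suffix m\<close> has only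
      \<open>m\<close> letters \<open>0\<close>.\<close>
    case (2 us)
    obtain m' where "m = Suc m'"
      using \<open>m \<ge> 2\<close> by (cases m) auto
    then obtain us' where us': "us = 1 # us'"
      using 2(1,3) by (cases us) (auto simp: rigid_suffix_def)
    have "concat (map \<sigma> p) = rigid_prefix r @ 1 # us'"
      using 2(2) us' by (simp add: P_def)
    then obtain e g f g1 g2 where g: "p = e @ g # f" "\<sigma> g = g1 @ 1 # g2" "rigid_prefix r = concat (map \<sigma> e) @ g1"
      by (rule concat_map_eq_append_ConsE)
    have g0: "g \<noteq> h" "count_list g1 0 = 0"
      using card_right[OF g(2)] g(1) by auto
    have "count_list (concat (map \<sigma> e)) 0 = count_list e h"
      by (rule count) (auto simp: g(1))
    then have "count_list e h = 2"
      using count_rigid_prefix(1)[of r] g g0 by simp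
    then have "count_list f h + count_list q h = m"
      using tight(3) g(1) g0 by simp
    then have "subseq (replicate (m + 1) h) (f @ h # q)"
      unfolding subseq_replicate_count by simp
    then have "subseq (g # replicate (m + 1) h) (p @ h # q)"
      using list_emb_append2[of "(=)" "g # replicate (m + 1) h" "g # f @ h # q" e] g(1) by simp
    then have "subseq (concat (map \<sigma> (g # replicate (m + 1) h))) ?U"
      by (rule image) simp
    then have "subseq (g1 @ 1 # (g2 @ replicate (m + 1) 0)) ?U"
      using image_replicate[of "m + 1"] g(2) by simp
    then have "subseq (g1 @ [1]) (rigid_prefix r) \<or> subseq (1 # (g2 @ replicate (m + 1) 0)) (rigid_suffix m)"
      by (rule subseq_split_Cons)
    moreover have "\<not> subseq (g1 @ [1]) (rigid_prefix r)"
      using list_emb_set[of "(=)" "g1 @ [1]" "rigid_prefix r" 1] count_rigid_prefix(2)[of r]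
      by (auto simp: count_list_0_iff)
    ultimately have "subseq (replicate (m + 1) 0) (rigid_suffix m)"
      using subseq_order.order_trans[of "replicate (m + 1) 0" "1 # (g2 @ replicate (m + 1) 0)"]
      by (auto intro: list_emb_append2)
    then show False
      unfolding subseq_replicate_count by (simp add: count_rigid_suffix)
  next
    \<comment> \<open>The place is the critical one. The variables in \<open>f\<close>, after the
      \<open>h\<close> that gives the second \<open>0\<close>, spell out \<open>z\<^sub>1\<close> to
      \<open>z\<^sub>r\<close>, and each of them now precedes \<open>m + 1\<close> occurrences of
      \<open>h\<close>.\<close>
    case 3
    have "concat (map \<sigma> p) = (0 # rev [2..<r + 2]) @ 0 # [2..<r + 2]"
      using 3(1) by (simp add: P_def rigid_prefix_def)
    then obtain e g f g1 g2 where g: "p = e @ g # f" "\<sigma> g = g1 @ 0 # g2" "[2..<r + 2] = g2 @ concat (map \<sigma> f)"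
      by (rule concat_map_eq_append_ConsE)
    have "g = h"
      using other[of g] g(1,2) by auto
    then have f: "concat (map \<sigma> f) = [2..<r + 2]"
      using g \<sigma>h by (auto simp: Cons_eq_append_conv)
    have "count_list (concat (map \<sigma> q)) 0 = count_list q h"
      by (rule count) auto
    then have "count_list q h = m"
      using 3(2) count_rigid_suffix[of m 0] by (simp add: Q_def)
    then have h: "subseq (replicate (m + 1) h) (h # q)"
      unfolding subseq_replicate_count by simp
    have short: "card (set (\<sigma> x)) \<le> 1" if "x \<in> set f" for x
    proof -
      obtain f1 f2 where f12: "f = f1 @ x # f2"
        using \<open>x \<in> set f\<close> by (meson split_list)
      have "subseq ([x] @ replicate (m + 1) h) (p @ h # q)"
        by (rule list_emb_append_mono[OF _ h]) (simp add: g f12 subseq_singleton_left)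
      then have sub: "subseq (\<sigma> x @ replicate (m + 1) 0) ?U"
        using image[of "x # replicate (m + 1) h"] image_replicate[of "m + 1"] by simp
      \<comment> \<open>Letters \<open>c < d\<close> in one image must be matched ahead of
        \<open>m + 1\<close> letters \<open>0\<close>, hence before the second \<open>0\<close>,
        where the \<open>z\<^sub>i\<close> decrease.\<close>
      have "\<sigma> x = [] \<or> (\<exists>c. \<sigma> x = [c])"
      proof (rule ccontr)
        assume "\<not> ?thesis"
        then obtain c d s where cd: "\<sigma> x = c # d # s"
          by (metis list.exhaust)
        have "sorted_wrt (<) (concat (map \<sigma> f))" "set (concat (map \<sigma> f)) = {2..<r + 2}"
          unfolding f by (simp_all del: upt_Suc)
        then have "c < d" "c \<ge> 2" "d \<ge> 2"
          by (auto simp: f12 cd sorted_wrt_append)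
        have "subseq ([c] @ d # (s @ replicate (m + 1) 0)) ((0 # rev [2..<r + 2]) @ (0 # [2..<r + 2] @ rigid_suffix m))"
          using sub cd by (simp add: rigid_prefix_def)
        then have "subseq ([c] @ [d]) (0 # rev [2..<r + 2]) \<or>
            subseq (d # (s @ replicate (m + 1) 0)) (0 # [2..<r + 2] @ rigid_suffix m)"
          by (rule subseq_split_Cons)
        then show False
        proof
          assume "subseq ([c] @ [d]) (0 # rev [2..<r + 2])"
          then have "subseq [c, d] (rev [2..<r + 2])"
            using \<open>c \<ge> 2\<close> by (simp del: upt_Suc)
          moreover have "sorted_wrt (\<lambda>x y. y < x) (rev [2..<r + 2])"
            by (simp add: sorted_wrt_rev del: upt_Suc)
          ultimately show False
            using \<open>c < d\<close> sorted_wrt_subseq_pair[of "\<lambda>x y. y < x" "rev [2..<r + 2]" c d]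
            by (simp del: upt_Suc)
        next
          assume "subseq (d # (s @ replicate (m + 1) 0)) (0 # [2..<r + 2] @ rigid_suffix m)"
          then have "subseq (d # (s @ replicate (m + 1) 0)) ([2..<r + 2] @ rigid_suffix m)"
            using \<open>d \<ge> 2\<close> by (simp del: upt_Suc)
          then have "subseq (replicate (m + 1) 0) ([2..<r + 2] @ rigid_suffix m)"
            by (rule subseq_order.order_trans[rotated])
              (intro list_emb_Cons list_emb_append2 subseq_order.order_refl)
          moreover have "count_list [2..<r + 2] 0 = 0"
            by (simp add: count_list_0_iff)
          ultimately show False
            unfolding subseq_replicate_count by (simp add: count_rigid_suffix del: upt_Suc)
        qed
      qed
      then show ?thesis by auto
    qed
    \<comment> \<open>Each variable contributes at most one of the \<open>r\<close> letters, so at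
      least \<open>r\<close> variables occur.\<close>
    have "r = card (set (concat (map \<sigma> f)))"
      unfolding f by (simp del: upt_Suc)
    also have "\<dots> = card (\<Union>x\<in>set f. set (\<sigma> x))"
      by simp
    also have "\<dots> \<le> (\<Sum>x\<in>set f. card (set (\<sigma> x)))"
      by (rule card_UN_le) simp
    also have "\<dots> \<le> (\<Sum>x\<in>set f. 1)"
      by (rule sum_mono) (rule short)
    also have "\<dots> \<le> card (set (p @ q))"
      using card_mono[of "set (p @ q)" "set f"] by (auto simp: g(1))
    finally show False
      using card by simp
  qed
qed

text \<open>Here the longer word is the one mapped into the rigid word. In it \<open>h\<close>
  occurs more than \<open>m + 2\<close> times, which is more often than any letter of the rigid
  word.\<close>

lemma rigid_delete:
  assumes sim: "simon (m + 2) (p @ q) (p @ h # q)" and "m \<ge> 2"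
    and eq: "\<alpha> @ concat (map \<sigma> (p @ h # q)) @ \<beta> = rigid_prefix r @ rigid_suffix m"
  shows "\<sigma> h = []"
proof (rule ccontr)
  assume "\<sigma> h \<noteq> []"
  then obtain c where c: "c \<in> set (\<sigma> h)"
    by (meson ex_in_conv set_empty)
  let ?k = "Suc (count_list (p @ q) h)"
  have "subseq (replicate ?k h) (p @ h # q)" "\<not> subseq (replicate ?k h) (p @ q)"
    unfolding subseq_replicate_count by simp_all
  then have "m + 2 < ?k"
    using simonD[OF sim, of "replicate ?k h"] by (metis length_replicate not_le)
  also have "1 \<le> count_list (\<sigma> h) c"
    using c count_list_0_iff[of "\<sigma> h" c] by linarith
  then have "?k \<le> ?k * count_list (\<sigma> h) c"
    using mult_le_mono2[of 1 "count_list (\<sigma> h) c" ?k] by (simp only: mult_1_right)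
  also have "?k * count_list (\<sigma> h) c \<le> count_list (concat (map \<sigma> (p @ h # q))) c"
    using count_list_concat_map_ge[of "p @ h # q" h \<sigma> c] by simp
  also have "\<dots> \<le> count_list (\<alpha> @ concat (map \<sigma> (p @ h # q)) @ \<beta>) c"
    by simp
  also have "\<dots> \<le> 2 + m"
    unfolding eq using count_rigid_prefix(3)[of r c] by (simp add: count_rigid_suffix)
  finally show False by simp
qed

text \<open>Along a chain of insertions, whenever either instance is a factor of the rigid word, the
  inserted variable is erased by \<open>\<sigma>\<close> and the instances agree; otherwise both
  values are zero.\<close>

lemma satisfies_rigid_factor_monoid:
  assumes "e \<in> J_identities (m + 2)" "m \<ge> 2" "card (set (fst e)) < r"
  shows "satisfies (factor_monoid (rigid_prefix r @ rigid_suffix m)) e"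
  unfolding monoid.satisfies_iff_word_value[OF monoid_factor_monoid]
proof (intro allI impI)
  let ?U = "rigid_prefix r @ rigid_suffix m"
  fix \<theta> :: "nat \<Rightarrow> nat list option"
  define \<sigma> where "\<sigma> = the \<circ> \<theta>"
  note val = word_value_factor_monoid[of ?U \<theta>, folded \<sigma>_def]
  show "word_value (factor_monoid ?U) \<theta> (fst e) = word_value (factor_monoid ?U) \<theta> (snd e)"
  proof (rule simon_imp_eq[where A = "set (fst e)" and n = "m + 2"])
    fix p q h
    assume sim: "simon (m + 2) (p @ q) (p @ h # q)" and sub: "set (p @ q) \<subseteq> set (fst e)"
    have "set (p @ q) = set (p @ h # q)"
      using simon_set[OF sim] by simp
    moreover have "concat (map \<sigma> (p @ h # q)) = concat (map \<sigma> (p @ q))"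
      if "sublist (concat (map \<sigma> (p @ q))) ?U \<or> sublist (concat (map \<sigma> (p @ h # q))) ?U"
    proof -
      have "card (set (p @ q)) < r"
        using card_mono[OF _ sub] assms(3) by simp
      then have "\<sigma> h = []"
        using that rigid_insert[OF sim assms(2)] rigid_delete[OF sim assms(2)] unfolding sublist_def by metis
      then show ?thesis by simp
    qed
    ultimately show "word_value (factor_monoid ?U) \<theta> (p @ h # q) = word_value (factor_monoid ?U) \<theta> (p @ q)"
      unfolding val by metis
  qed (use assms(1) in \<open>auto simp: J_identities_iff\<close>)
qed

lemma not_satisfies_rigid_factor_monoid:
  "\<not> satisfies (factor_monoid (rigid_prefix r @ rigid_suffix m))
      (rigid_prefix r @ rigid_suffix m, rigid_prefix r @ 0 # rigid_suffix m)"
proof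
  let ?U = "rigid_prefix r @ rigid_suffix m" and ?V = "rigid_prefix r @ 0 # rigid_suffix m"
  assume sat: "satisfies (factor_monoid ?U) (?U, ?V)"
  \<comment> \<open>Letters of the word stand for themselves, and the remaining variables are sent
    to zero to stay in the carrier. The second word is longer than the first, so it is no factor of
    it and gets the value zero.\<close>
  define \<theta> where "\<theta> x = (if x \<in> set ?U then Some [x] else None)" for x
  have "sublist [x] ?U" if "x \<in> set ?U" for x
    using that unfolding sublist_def by (metis append_Cons append_Nil split_list)
  then have "range \<theta> \<subseteq> carrier (factor_monoid ?U)"
    by (auto simp: \<theta>_def factor_monoid_def)
  then have "word_value (factor_monoid ?U) \<theta> ?U = word_value (factor_monoid ?U) \<theta> ?V"
    using sat unfolding monoid.satisfies_iff_word_value[OF monoid_factor_monoid] by simp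
  moreover have "concat (map (the \<circ> \<theta>) ?U) = ?U"
  proof -
    have "concat (map (the \<circ> \<theta>) ?U) = concat (map (\<lambda>x. [x]) ?U)"
      by (rule arg_cong[where f = concat], rule map_cong) (simp_all add: \<theta>_def)
    also have "\<dots> = ?U"
      by simp
    finally show ?thesis .
  qed
  then have "word_value (factor_monoid ?U) \<theta> ?U = Some ?U"
    unfolding word_value_factor_monoid by (simp add: \<theta>_def)
  moreover have "concat (map (the \<circ> \<theta>) ?V) = ?V"
  proof -
    have "0 \<in> set ?U"
      by (simp add: rigid_prefix_def)
    then have "concat (map (the \<circ> \<theta>) ?V) = concat (map (\<lambda>x. [x]) ?V)"
      by (intro arg_cong[where f = concat] map_cong) (auto simp add: \<theta>_def)
    also have "\<dots> = ?V"
      by simp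
    finally show ?thesis .
  qed
  then have "word_value (factor_monoid ?U) \<theta> ?V = None"
    unfolding word_value_factor_monoid by (auto dest: sublist_length_le)
  ultimately show False by simp
qed

lemma not_finitely_based_styl:
  assumes "n \<ge> 4"
  shows "\<not> finitely_based TYPE('u::infinite) (styl n)"
proof
  assume "finitely_based TYPE('u) (styl n)"
  then obtain B where B: "finite B" "is_basis TYPE('u) B (styl n)"
    by (auto simp: finitely_based_def)
  define m where "m = n - 2"
  have m: "n = m + 2" "m \<ge> 2" "n \<ge> 1"
    using assms by (auto simp: m_def)
  \<comment> \<open>It suffices to bound the variables on the left-hand sides: the two sides of an
    identity of the stylic monoid contain the same variables.\<close>
  obtain r where r: "\<And>e. e \<in> B \<Longrightarrow> card (set (fst e)) < r"
    using finite_nat_set_iff_bounded[of "(\<lambda>e. card (set (fst e))) ` B"] B(1) by auto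
  let ?F = "factor_monoid (rigid_prefix r @ rigid_suffix m)"
  let ?e = "(rigid_prefix r @ rigid_suffix m, rigid_prefix r @ 0 # rigid_suffix m)"
  obtain N :: "'u monoid" where N: "N \<in> copies ?F"
    using finite_copyE[OF monoid_factor_monoid finite_factor_monoid] by blast
  note sat = satisfies_copies[OF monoid_factor_monoid N]
  have "satisfies N e" if "e \<in> B" for e
  proof -
    have "satisfies (styl n) e"
      using B(2) that by (simp add: is_basis_def)
    then have "e \<in> J_identities (m + 2)"
      using satisfies_styl_iff[OF m(3)] m(1) by simp
    then show ?thesis
      unfolding sat using satisfies_rigid_factor_monoid m(2) r[OF that] by blast
  qed
  then have "N \<in> models B"
    using N by (simp add: models_def copies_def)
  moreover have "satisfies (styl n) ?e"
    using satisfies_styl_iff[OF m(3)] simon_rigid m(1) by (simp add: J_identities_iff)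
  ultimately have "satisfies N ?e"
    using B(2) unfolding is_basis_def by blast
  then show False
    using not_satisfies_rigid_factor_monoid sat by blast
qed

theorem corollary4p2:
  shows "(\<forall>n\<ge>1.
      (generated_variety (styl n) :: 'u::infinite monoid set) = models (J_identities n) \<and>
      (generated_pseudovariety (copies (styl n)) :: 'u monoid set) = J_pseudovariety n \<and>
      (generated_variety (styl n) :: 'u monoid set) \<subset> generated_variety (styl (n + 1)) \<and>
      (finitely_based TYPE('u) (styl n) \<longleftrightarrow> n \<le> 3)) \<and>
    (let x = 0; y = 1 in
      is_basis TYPE('u) {([x,x], [x]), ([x,y], [y,x])} (styl 1)) \<and>
    (let x = 0; y = 1; z = 2 in
      is_basis TYPE('u)
        {([x,y,x,z,x], [x,y,z,x]),
         ([x,y,x,y], [y,x,y,x])} (styl 2)) \<and>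
    (let x = 0; y = 1; z = 2; t = 3 in
      is_basis TYPE('u)
        {([x,y,x,x,z,x], [x,y,x,z,x]),
         ([x,y,z,x,x,t,z], [x,y,x,z,x,x,t,z]),
         ([z,y,x,x,z,t,x], [z,y,x,x,z,x,t,x]),
         ([x,y,x,y,x,y], [y,x,y,x,y,x])} (styl 3))"
proof -
  have bases:
    "is_basis TYPE('u) {([0, 0], [0]), ([0, 1], [1, 0])} (styl 1)"
    "is_basis TYPE('u) {([0, 1, 0, 2, 0], [0, 1, 2, 0]), ([0, 1, 0, 1], [1, 0, 1, 0])} (styl 2)"
    "is_basis TYPE('u)
      {([0, 1, 0, 0, 2, 0], [0, 1, 0, 2, 0]),
       ([0, 1, 2, 0, 0, 3, 2], [0, 1, 0, 2, 0, 0, 3, 2]),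
       ([2, 1, 0, 0, 2, 3, 0], [2, 1, 0, 0, 2, 0, 3, 0]),
       ([0, 1, 0, 1, 0, 1], [1, 0, 1, 0, 1, 0])} (styl 3)"
    by (rule is_basis_styl_1 is_basis_styl_2 is_basis_styl_3, simp)+
  have "finitely_based TYPE('u) (styl 1)" "finitely_based TYPE('u) (styl 2)" "finitely_based TYPE('u) (styl 3)"
    unfolding finitely_based_def by (rule exI, rule conjI[rotated], rule bases, simp)+
  then have fb: "finitely_based TYPE('u) (styl n) \<longleftrightarrow> n \<le> 3" if n: "n \<ge> 1" for n
  proof (cases "n \<le> 3")
    case True
    then consider "n = 1" | "n = 2" | "n = 3"
      using n by linarith
    then show ?thesis
      by cases (simp_all add: \<open>finitely_based TYPE('u) (styl 1)\<close>[simplified]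
        \<open>finitely_based TYPE('u) (styl 2)\<close> \<open>finitely_based TYPE('u) (styl 3)\<close>)
  next
    case False
    then show ?thesis
      using not_finitely_based_styl[of n, where 'u = 'u] by simp
  qed
  show ?thesis
    unfolding Let_def
    by (intro conjI allI impI bases fb generated_variety_styl generated_pseudovariety_styl
        generated_variety_styl_strict)
qed

end
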